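(* There exists an increasing sequence $(m_n)_{n\geq 1}$ of natural numbers such that: (1) there exists a weakly mixing invertible measure-preserving transformation of a standard non-atomic probability space for which $(m_n)$ is a rigidity sequence; and (2) $(m_n)$ is not a rigidity sequence for any invertible probability measure-preserving system with a discrete part in its spectrum, i.e. for any invertible probability measure-preserving system whose Koopman operator has an eigenvalue $\lambda\neq 1$.
   Context: Let $T$ be an invertible measure-preserving transformation of a probability space $(X,\mathcal{B},\nu)$. Its Koopman operator is $U_T f=f\circ T$ on $L^2(X,\nu)$. An increasing sequence $(m_n)$ of natural numbers is a rigidity sequence (rigidity time) for $T$ if $\|f\circ T^{m_n}-f\|_{L^2(\nu)}\to 0$ as $n\to\infty$ for every $f\in L^2(X,\nu)$. An eigenvalue of $U_T$ is a $\lambda\in\mathbb{C}$ such that $f\circ T=\lambda f$ for some nonzero $f\in L^2(X,\nu)$. $T$ is weakly mixing if the only eigenfunctions of $U_T$ are the constants. *)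

theory Defs
  imports "HOL-Probability.Probability"
begin

text \<open>
  Invertibility is pointwise on the underlying space: a measurable bijection with measurable inverse.
\<close>

definition invertible_mp :: "'a measure \<Rightarrow> ('a \<Rightarrow> 'a) \<Rightarrow> bool" where
  "invertible_mp M T \<longleftrightarrow>
     bij_betw T (space M) (space M) \<and>
     T \<in> measurable M M \<and>
     the_inv_into (space M) T \<in> measurable M M \<and>
     distr M M T = M"

definition invertible_pmp_system :: "'a measure \<Rightarrow> ('a \<Rightarrow> 'a) \<Rightarrow> bool" where
  "invertible_pmp_system M T \<longleftrightarrow> prob_space M \<and> invertible_mp M T"

text \<open>
  Elements of the complex space \<open>L\<^sup>2\<close> are represented by functions, so that equality in
  \<open>L\<^sup>2\<close> is equality almost everywhere.
\<close>

definition in_L2 :: "'a measure \<Rightarrow> ('a \<Rightarrow> complex) \<Rightarrow> bool" where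
  "in_L2 M f \<longleftrightarrow> f \<in> borel_measurable M \<and> integrable M (\<lambda>x. (norm (f x))\<^sup>2)"

definition L2_norm :: "'a measure \<Rightarrow> ('a \<Rightarrow> complex) \<Rightarrow> real" where
  "L2_norm M f = sqrt (\<integral>x. (norm (f x))\<^sup>2 \<partial>M)"

definition koopman :: "('a \<Rightarrow> 'a) \<Rightarrow> ('a \<Rightarrow> complex) \<Rightarrow> 'a \<Rightarrow> complex" where
  "koopman T f = f \<circ> T"

definition koopman_eigenfunction ::
    "'a measure \<Rightarrow> ('a \<Rightarrow> 'a) \<Rightarrow> complex \<Rightarrow> ('a \<Rightarrow> complex) \<Rightarrow> bool" where
  "koopman_eigenfunction M T \<mu> f \<longleftrightarrow>
     in_L2 M f \<and> \<not> (AE x in M. f x = 0) \<and> (AE x in M. koopman T f x = \<mu> * f x)"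

definition koopman_eigenvalue :: "'a measure \<Rightarrow> ('a \<Rightarrow> 'a) \<Rightarrow> complex \<Rightarrow> bool" where
  "koopman_eigenvalue M T \<mu> \<longleftrightarrow> (\<exists>f. koopman_eigenfunction M T \<mu> f)"

definition weakly_mixing :: "'a measure \<Rightarrow> ('a \<Rightarrow> 'a) \<Rightarrow> bool" where
  "weakly_mixing M T \<longleftrightarrow>
     (\<forall>\<mu> f. koopman_eigenfunction M T \<mu> f \<longrightarrow> (\<exists>c. AE x in M. f x = c))"

definition rigidity_sequence :: "'a measure \<Rightarrow> ('a \<Rightarrow> 'a) \<Rightarrow> (nat \<Rightarrow> nat) \<Rightarrow> bool" where
  "rigidity_sequence M T m \<longleftrightarrow>
     (\<forall>f. in_L2 M f \<longrightarrow> (\<lambda>n. L2_norm M (\<lambda>x. f ((T ^^ m n) x) - f x)) \<longlonglongrightarrow> 0)"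

text \<open>The measurable sets are the Borel sets of some Polish topology on the space.\<close>

definition standard_borel :: "'a measure \<Rightarrow> bool" where
  "standard_borel M \<longleftrightarrow>
     (\<exists>X. completely_metrizable_space X \<and> second_countable X \<and>
          topspace X = space M \<and> sets M = sigma_sets (space M) {U. openin X U})"

definition non_atomic :: "'a measure \<Rightarrow> bool" where
  "non_atomic M \<longleftrightarrow>
     (\<forall>A \<in> sets M. emeasure M A > 0 \<longrightarrow>
        (\<exists>B \<in> sets M. B \<subseteq> A \<and> 0 < emeasure M B \<and> emeasure M B < emeasure M A))"

definition standard_nonatomic_prob_space :: "'a measure \<Rightarrow> bool" where
  "standard_nonatomic_prob_space M \<longleftrightarrow> prob_space M \<and> standard_borel M \<and> non_atomic M"

text \<open>
  A quantifier over all probability spaces cannot be nested below a quantifier over \<open>m\<close>, since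
  types are only quantified at the outermost level. The underlying type is therefore passed as an
  argument, so that one and the same \<open>m\<close> can be compared on different types.
\<close>

definition never_rigid_with_eigenvalue :: "'a itself \<Rightarrow> (nat \<Rightarrow> nat) \<Rightarrow> bool" where
  "never_rigid_with_eigenvalue _ m \<longleftrightarrow>
     (\<forall>(M :: 'a measure) T \<mu>.
        invertible_pmp_system M T \<and> koopman_eigenvalue M T \<mu> \<and> \<mu> \<noteq> 1 \<longrightarrow>
        \<not> rigidity_sequence M T m)"

text \<open>
  How ``there is \<open>m\<close> such that for all types \<open>'a\<close>'' is stated: with \<open>'a\<close> a free type variable, the
  formula \<open>\<exists>m. \<dots> \<and> never_rigid_with_eigenvalue TYPE('a) m\<close> alone would let \<open>m\<close> depend on \<open>'a\<close>.
  Instead one asserts the existence of \<open>m\<close> for systems carried by the fixed type \<^typ>\<open>real\<close>, which is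
  large enough to carry every standard Borel space, together with the assertion that any such \<open>m\<close>
  also works for systems carried by \<open>'a\<close>. The two together give one \<open>m\<close> for all types.
\<close>

end

theory Submission
  imports Defs
begin

text \<open>
  Write \<open>1 = m\<^sub>1 + \<dots> + m\<^sub>N\<close>. If a complex number \<open>\<lambda>\<close> of modulus one satisfies \<open>\<bar>\<lambda>\<^sup>x - 1\<bar> \<le> 1/2\<close> for
  all \<open>x = 2\<^sup>j m\<^sub>i\<close> with \<open>j \<le> N\<close>, then doubling gives \<open>\<bar>\<lambda>\<^sup>m - 1\<bar> \<le> (2/3)\<^sup>N\<close> for each \<open>m = m\<^sub>i\<close>, hence
  \<open>\<bar>\<lambda> - 1\<bar> \<le> N (2/3)\<^sup>N\<close>, which tends to \<open>0\<close>. So a sequence that exhausts such families for arbitrarily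
  large \<open>N\<close> forces every eigenvalue of every system rigid along it to be \<open>1\<close>. In particular a system
  rigid along it is weakly mixing as soon as it is ergodic.

  Such an ergodic system is a rank-one transformation: the tower \<open>k + 1\<close> consists of \<open>N = k + 2\<close>
  sections, in the section \<open>i\<close> the tower \<open>k\<close> is repeated very often with period \<open>q\<^sub>i\<close>, and
  \<open>q\<^sub>1, \<dots>, q\<^sub>N\<close> are pairwise coprime. By Bezout, \<open>1 = m\<^sub>1 + \<dots> + m\<^sub>N\<close> with \<open>m\<^sub>i\<close> a multiple of \<open>q\<^sub>l\<close> for all
  \<open>l \<noteq> i\<close>. Translation by a multiple of \<open>m\<^sub>i\<close> thus disturbs only the section \<open>i\<close>, which has measure
  about \<open>1/N\<close>.
\<close>

section \<open>One cutting step\<close>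

text \<open>Induction on \<open>n\<close>: a Bezout relation between \<open>q n\<close> and the
  product of the earlier moduli writes 1 as a sum of two terms. The earlier family, multiplied by
  \<open>b * q n\<close>, sums to one of them, and the other becomes the new member.\<close>

lemma exists_bezout_family:
  fixes q :: "nat \<Rightarrow> int"
  assumes "\<And>i j. i < j \<Longrightarrow> j < n \<Longrightarrow> coprime (q i) (q j)" and "0 < n"
  shows "\<exists>m. (\<Sum>i<n. m i) = 1 \<and> (\<forall>i<n. \<forall>l<n. l \<noteq> i \<longrightarrow> q l dvd m i)"
  using assms
proof (induction n)
  case 0
  then show ?case by simp
next
  case (Suc n)
  show ?case
  proof (cases "n = 0")
    case True
    then show ?thesis by (intro exI[of _ "\<lambda>_. 1"]) auto
  next
    case False
    then obtain m where m: "(\<Sum>i<n. m i) = 1" "\<And>i l. i < n \<Longrightarrow> l < n \<Longrightarrow> l \<noteq> i \<Longrightarrow> q l dvd m i"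
      using Suc by (metis less_SucI gr0I)
    have "coprime (\<Prod>i<n. q i) (q n)"
      by (intro prod_coprime_left) (use Suc.prems in auto)
    then obtain a b where ab: "a * (\<Prod>i<n. q i) + b * q n = 1"
      by (metis bezout_int coprime_imp_gcd_eq_1)
    define m' where "m' i = (if i < n then b * q n * m i else a * (\<Prod>i<n. q i))" for i
    have "(\<Sum>i<Suc n. m' i) = b * q n * (\<Sum>i<n. m i) + a * (\<Prod>i<n. q i)"
      by (simp add: m'_def sum_distrib_left)
    then have "(\<Sum>i<Suc n. m' i) = 1" using ab m by simp
    moreover have "q l dvd m' i" if "i < Suc n" "l < Suc n" "l \<noteq> i" for i l
    proof (cases "i < n")
      case True
      then show ?thesis using that m(2)[of i l] by (cases "l = n") (auto simp: m'_def)
    next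
      case False
      then have "q l dvd (\<Prod>i<n. q i)" using that by (intro dvd_prodI) auto
      then show ?thesis using False by (simp add: m'_def)
    qed
    ultimately show ?thesis by blast
  qed
qed

text \<open>A common prime factor divides the difference \<open>fact N * (j - i)\<close>. Since
  \<open>j - i \<le> N\<close>, it divides \<open>fact N\<close> in either case, but both numbers
  are 1 modulo \<open>fact N\<close>.\<close>

lemma coprime_one_plus_fact_mult:
  fixes a i j N :: nat
  assumes "i < j" "j < N"
  shows "coprime (1 + fact N * (a + i)) (1 + fact N * (a + j))"
proof (rule ccontr)
  assume "\<not> coprime (1 + fact N * (a + i)) (1 + fact N * (a + j))"
  then obtain r where r: "prime r" "r dvd 1 + fact N * (a + i)" "r dvd 1 + fact N * (a + j)"
    using prime_factor_nat[of "gcd (1 + fact N * (a + i)) (1 + fact N * (a + j))"]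
    by (metis coprime_iff_gcd_eq_1 gcd_greatest_iff)
  have "r dvd (1 + fact N * (a + j)) - (1 + fact N * (a + i))"
    using r by (intro dvd_diff_nat)
  also have "\<dots> = fact N * (a + j) - fact N * (a + i)" by simp
  also have "\<dots> = fact N * (j - i)"
    unfolding diff_mult_distrib2[symmetric] by simp
  finally have "r dvd fact N \<or> r dvd (j - i)"
    using r(1) by (simp add: prime_dvd_mult_iff)
  then have "r dvd fact N"
  proof
    assume "r dvd j - i"
    then have "r \<le> N" using assms dvd_imp_le[of r "j - i"] by linarith
    then show ?thesis using prime_ge_1_nat[OF r(1)] by (intro dvd_fact)
  qed
  then have "r dvd 1" using r(2) by (metis dvd_add_left_iff dvd_mult2)
  then show False using r(1) by simp
qed

text \<open>Squaring expands the distance to \<open>1\<close> by at least \<open>3/2\<close> near \<open>1\<close>.\<close>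

lemma dist_one_le_of_doubling:
  fixes z :: complex
  assumes "\<And>j. j \<le> n \<Longrightarrow> norm (z ^ (2 ^ j) - 1) \<le> 1/2"
  shows "norm (z - 1) \<le> (2/3) ^ n"
  using assms
proof (induction n arbitrary: z)
  case 0
  then show ?case using 0[of 0] by simp
next
  case (Suc n)
  have z: "norm (z - 1) \<le> 1/2" using Suc.prems[of 0] by simp
  have "norm (z\<^sup>2 - 1) \<le> (2/3) ^ n"
  proof (rule Suc.IH)
    fix j assume "j \<le> n"
    then show "norm ((z\<^sup>2) ^ 2 ^ j - 1) \<le> 1/2"
      using Suc.prems[of "Suc j"] by (simp add: power_mult[symmetric])
  qed
  moreover have "z\<^sup>2 - 1 = (z + 1) * (z - 1)" by (simp add: power2_eq_square algebra_simps)
  ultimately have 1: "norm (z + 1) * norm (z - 1) \<le> (2/3) ^ n" by (simp add: norm_mult)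
  have "norm (2::complex) \<le> norm (z + 1) + norm (z - 1)"
    using norm_triangle_ineq4[of "z + 1" "z - 1"] by simp
  then have "3/2 \<le> norm (z + 1)" using z by simp
  then have "3/2 * norm (z - 1) \<le> norm (z + 1) * norm (z - 1)" by (intro mult_right_mono) auto
  then show ?case using 1 by simp
qed

text \<open>Multiplication by a power of \<open>l\<close> is an isometry of the plane, so distances
  to 1 add up along the partial sums of \<open>m\<close>. It also makes the exponents
  \<open>k\<close> and \<open>-k\<close> equally far from 1, which allows negative
  \<open>m i\<close>.\<close>

lemma norm_power_int_minus_one_le:
  fixes l :: complex
  assumes "norm l = 1" "(\<Sum>i<N. m i) = (1::int)" "\<And>i. i < N \<Longrightarrow> norm (l ^ nat \<bar>m i\<bar> - 1) \<le> e"
  shows "norm (l - 1) \<le> real N * e"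
proof -
  have nl: "norm (l powi k) = 1" for k using assms(1) by (simp add: norm_power_int)
  have l0: "l \<noteq> 0" using assms(1) by auto
  have e: "norm (l powi (m i) - 1) \<le> e" if "i < N" for i
  proof (cases "m i \<ge> 0")
    case True
    then show ?thesis using assms(3)[OF that] by (simp add: power_int_def)
  next
    case False
    then have "l powi (m i) * l ^ nat \<bar>m i\<bar> = 1"
      using l0 by (simp add: power_int_def power_inverse)
    then have "l powi (m i) - 1 = l powi (m i) * (1 - l ^ nat \<bar>m i\<bar>)"
      by (simp add: algebra_simps)
    then have "norm (l powi (m i) - 1) = norm (1 - l ^ nat \<bar>m i\<bar>)" by (simp add: norm_mult nl)
    then show ?thesis using assms(3)[OF that] by (simp add: norm_minus_commute)
  qed
  have "norm (l powi (\<Sum>i<n. m i) - 1) \<le> real n * e" if "n \<le> N" for n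
    using that
  proof (induction n)
    case (Suc n)
    have "l powi (\<Sum>i<Suc n. m i) - 1 = l powi (\<Sum>i<n. m i) * (l powi m n - 1) + (l powi (\<Sum>i<n. m i) - 1)"
      using l0 by (simp add: power_int_add algebra_simps)
    then have "norm (l powi (\<Sum>i<Suc n. m i) - 1) \<le>
        norm (l powi (\<Sum>i<n. m i) * (l powi m n - 1)) + norm (l powi (\<Sum>i<n. m i) - 1)"
      by (metis norm_triangle_ineq)
    also have "\<dots> \<le> e + real n * e" using Suc e[of n] by (simp add: norm_mult nl)
    finally show ?case by (simp add: algebra_simps)
  qed simp
  from this[of N] show ?thesis using assms(2) by simp
qed

text \<open>
  From a tower of height \<open>h\<close> to one of height \<open>h'\<close>: \<open>P\<close> is the set of positions at which the copies
  of the old tower start in the new one, the remaining \<open>h' - h * card P\<close> levels being spacers, and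
  the elements of \<open>F\<close> are the times that become rigidity times. No copy reaches the bottom or the top
  of the new tower, which makes the limit transformation and its inverse defined everywhere.
\<close>

definition cutting_step ::
    "nat \<Rightarrow> real \<Rightarrow> nat \<Rightarrow> nat \<Rightarrow> nat set \<Rightarrow> nat set \<Rightarrow> bool" where
  "cutting_step N \<delta> h h' P F \<longleftrightarrow>
    finite P \<and> 2 \<le> card P \<and> 0 \<notin> P \<and> (\<forall>s\<in>P. s + h < h') \<and>
    (\<forall>s\<in>P. \<forall>s'\<in>P. s < s' \<longrightarrow> s + h \<le> s') \<and>
    real h' \<le> real (card P) * (real h * (1 + \<delta>)) \<and>
    finite F \<and> F \<noteq> {} \<and> (\<forall>m\<in>F. h \<le> m \<and> N * card {s \<in> P. s + m \<notin> P} \<le> 2 * card P) \<and>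
    (\<forall>l::complex. norm l = 1 \<longrightarrow> (\<forall>m\<in>F. norm (l ^ m - 1) \<le> 1/2) \<longrightarrow>
       norm (l - 1) \<le> real N * (2/3) ^ N)"

text \<open>
  The new word is \<open>1 (W 1\<^sup>s\<^sup>0)\<^sup>R (W 1\<^sup>s\<^sup>1)\<^sup>R \<dots>\<close> with \<open>N\<close> sections, the section \<open>i\<close> having period
  \<open>q i = h + s i\<close>; \<open>1\<close> stands for a spacer. The periods are pairwise coprime by Goedel's choice \<open>q i \<equiv> 1 (mod N!)\<close>.
\<close>

lemma exists_cutting_step:
  fixes N h H :: nat and \<delta> :: real
  assumes N: "2 \<le> N" and h: "0 < h" and \<delta>: "real (2 + fact N * N) \<le> \<delta> * real h"
  shows "\<exists>h' P F. H \<le> h' \<and> cutting_step N \<delta> h h' P F"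
proof -
  \<comment> \<open>The summand \<open>h div fact N + 1\<close> is the least multiplier that lifts a
    multiple of \<open>fact N\<close> above \<open>h\<close>. Hence every period exceeds
    \<open>h\<close>, but by at most \<open>1 + fact N * N\<close>, a bound independent of
    \<open>h\<close>.\<close>
  define q where "q i = 1 + fact N * ((h div fact N + 1) + i)" for i
  have q_gt: "h < q i" for i
  proof -
    have "h < fact N * (h div fact N) + fact N"
      using dividend_less_times_div[of "fact N" h] by (simp add: add.commute)
    then show ?thesis by (simp add: q_def algebra_simps)
  qed
  have q_le: "q i \<le> 1 + h + fact N * N" if "i < N" for i
  proof -
    have "fact N * (h div fact N) \<le> h" by simp
    moreover have "fact N * (1 + i) \<le> fact N * N" using that by (intro mult_left_mono) auto
    moreover have "q i = 1 + fact N * (h div fact N) + fact N * (1 + i)"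
      by (simp add: q_def algebra_simps)
    ultimately show ?thesis by linarith
  qed
  have "coprime (int (q i)) (int (q j))" if "i < j" "j < N" for i j
    using coprime_one_plus_fact_mult[OF that, of "h div fact N + 1"]
    unfolding q_def coprime_int_iff .
  then obtain m :: "nat \<Rightarrow> int" where m_sum: "(\<Sum>i<N. m i) = 1"
    and m_dvd: "\<And>i l. i < N \<Longrightarrow> l < N \<Longrightarrow> l \<noteq> i \<Longrightarrow> int (q l) dvd m i"
    using exists_bezout_family[of N "\<lambda>i. int (q i)"] N by auto
  \<comment> \<open>The powers of two are the ones consumed by
    \<open>dist_one_le_of_doubling\<close>. Zero coefficients are left out because they would
    contribute the time 0, whereas all times must be at least \<open>h\<close>.\<close>
  define F where "F = (\<lambda>(i, j). 2 ^ j * nat \<bar>m i\<bar>) ` ({i. i < N \<and> m i \<noteq> 0} \<times> {..N})"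
  have F_fin: "finite F" by (simp add: F_def)
  have F_ne: "F \<noteq> {}"
  proof -
    have "\<exists>i<N. m i \<noteq> 0" using m_sum by (metis lessThan_iff sum.neutral zero_neq_one)
    then show ?thesis unfolding F_def by fastforce
  qed
  \<comment> \<open>\<open>R\<close> is the number of copies in each section. The term
    \<open>N * Max F\<close> makes the losses at the ends of all sections together no larger than
    one section, \<open>H\<close> makes the new tower tall enough, and 1 keeps \<open>R\<close>
    positive.\<close>
  define R where "R = N * Max F + H + 1"
  \<comment> \<open>Section \<open>i\<close> starts at \<open>b i\<close>, its copy number
    \<open>r\<close> at \<open>f i r\<close>; the leading 1 is the spacer at the bottom of the new
    tower.\<close>
  define b where "b i = 1 + (\<Sum>l<i. R * q l)" for i
  define f where "f i r = b i + r * q i" for i r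
  define P where "P = (\<lambda>(i, r). f i r) ` ({..<N} \<times> {..<R})"
  have b_mono: "b i \<le> b j" if "i \<le> j" for i j
    using that by (auto simp: b_def intro!: sum_mono2)
  have f_next: "f i r + q i \<le> b (Suc i)" if "r < R" for i r
  proof -
    have "(r + 1) * q i \<le> R * q i" using that by (intro mult_right_mono) auto
    then show ?thesis by (simp add: f_def b_def)
  qed
  have f_sep: "f i r + q i \<le> f j t" if "r < R" "i < j \<or> i = j \<and> r < t" for i j r t
  proof (cases "i < j")
    case True
    then show ?thesis using f_next[OF that(1), of i] b_mono[of "Suc i" j] by (simp add: f_def)
  next
    case False
    then have "i = j" "(r + 1) * q i \<le> t * q i" using that by (auto simp del: add_mult_distrib mult_Suc intro!: mult_right_mono)
    then show ?thesis by (simp add: f_def)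
  qed
  have f_less: "i < j \<or> i = j \<and> r < t" if "f i r < f j t" "r < R" "t < R" for i j r t
    using f_sep[of t j i r] that by (metis add_leD1 linorder_neqE_nat linorder_not_less less_irrefl)
  have "inj_on (\<lambda>(i, r). f i r) ({..<N} \<times> {..<R})"
  proof (intro inj_onI, clarsimp)
    fix i r j t assume "r < R" "t < R" "f i r = f j t"
    then show "i = j \<and> r = t"
      using f_sep[of r i j t] f_sep[of t j i r] q_gt[of i] q_gt[of j]
      by (metis add_le_same_cancel1 gr_implies_not0 le_zero_eq linorder_neqE_nat)
  qed
  then have card_P: "card P = N * R" unfolding P_def by (subst card_image) auto
  have P_fin: "finite P" by (simp add: P_def)
  have "2 * 1 \<le> N * R" using N by (intro mult_mono) (auto simp: R_def)
  then have P2: "2 \<le> card P" by (simp add: card_P)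
  have P0: "0 \<notin> P" by (auto simp: P_def f_def b_def)
  have P_top: "s + h < b N" if "s \<in> P" for s
  proof -
    from that obtain i r where s: "s = f i r" "i < N" "r < R" by (auto simp: P_def)
    then show ?thesis using f_next[of r i] q_gt[of i] b_mono[of "Suc i" N] by linarith
  qed
  have P_sep: "s + h \<le> s'" if s: "s \<in> P" "s' \<in> P" "s < s'" for s s'
  proof -
    from s obtain i r j t where *: "s = f i r" "r < R" "s' = f j t" "t < R" by (auto simp: P_def)
    then have "f i r + q i \<le> f j t" using f_less s f_sep by blast
    then show ?thesis using * q_gt[of i] by linarith
  qed
  have bN_le: "real (b N) \<le> real (card P) * (real h * (1 + \<delta>))"
  proof -
    have "(\<Sum>l<N. R * q l) \<le> (\<Sum>l<N. R * (1 + h + fact N * N))"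
      using q_le by (intro sum_mono mult_left_mono) auto
    then have "b N \<le> 1 + N * R * (1 + h + fact N * N)" by (simp add: b_def algebra_simps)
    \<comment> \<open>The leading spacer is charged to the \<open>N * R\<close> copies, which is why
      the hypothesis on \<open>\<delta>\<close> has 2 where \<open>q_le\<close> has 1.\<close>
    also have "\<dots> \<le> N * R * (2 + h + fact N * N)"
    proof -
      have "N * R * (2 + h + fact N * N) = N * R * (1 + h + fact N * N) + N * R"
        by (simp add: algebra_simps)
      then show ?thesis using P2 card_P by linarith
    qed
    finally have "real (b N) \<le> real (N * R * (2 + h + fact N * N))" by (rule of_nat_mono)
    also have "\<dots> = real (card P) * (real h + real (2 + fact N * N))" by (simp add: card_P algebra_simps)
    also have "\<dots> \<le> real (card P) * (real h + \<delta> * real h)"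
      using \<delta> by (intro mult_left_mono add_left_mono) auto
    finally show ?thesis by (simp add: algebra_simps)
  qed
  have H_le: "H \<le> b N"
  proof -
    have "R * q 0 \<le> (\<Sum>l<N. R * q l)" using N by (intro member_le_sum) auto
    moreover have "R * 1 \<le> R * q 0" by (intro mult_left_mono) (auto simp: q_def)
    ultimately show ?thesis by (simp add: b_def R_def)
  qed
  have F_good: "h \<le> k \<and> N * card {s \<in> P. s + k \<notin> P} \<le> 2 * card P" if "k \<in> F" for k
  proof -
    from that obtain i j where k: "k = 2 ^ j * nat \<bar>m i\<bar>" "i < N" "m i \<noteq> 0"
      by (auto simp: F_def)
    have dvd: "q l dvd k" if "l < N" "l \<noteq> i" for l
    proof -
      have "int (q l) dvd \<bar>m i\<bar>" using m_dvd[OF k(2) that] by simp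
      then have "q l dvd nat \<bar>m i\<bar>" by (simp add: nat_dvd_iff)
      then show ?thesis by (simp add: k)
    qed
    have k_pos: "0 < k" using k by simp
    have "h \<le> k"
    proof -
      \<comment> \<open>As \<open>2 \<le> N\<close>, there is another section, and its period
        divides \<open>k\<close> and exceeds \<open>h\<close>.\<close>
      obtain l where "l < N" "l \<noteq> i" using N by (metis One_nat_def Suc_1 Suc_le_lessD less_numeral_extra(1) order_less_trans zero_less_Suc zero_neq_one)
      then show ?thesis using dvd_imp_le[OF dvd k_pos] q_gt[of l] by force
    qed
    \<comment> \<open>In a section \<open>l\<close> other than \<open>i\<close>, translation by
      \<open>k = q l * d\<close> moves a copy forward by \<open>d \<le> k\<close> copies. It can
      therefore miss \<open>P\<close> only from the last \<open>k\<close> copies; section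
      \<open>i\<close> is given up entirely.\<close>
    have "{s \<in> P. s + k \<notin> P} \<subseteq> f i ` {..<R} \<union> (\<Union>l<N. f l ` {R - k..<R})"
    proof
      fix s assume "s \<in> {s \<in> P. s + k \<notin> P}"
      then have s: "s \<in> P" "s + k \<notin> P" by auto
      then obtain l r where lr: "s = f l r" "l < N" "r < R" by (auto simp: P_def)
      show "s \<in> f i ` {..<R} \<union> (\<Union>l<N. f l ` {R - k..<R})"
      proof (cases "l = i")
        case True
        then show ?thesis using lr by auto
      next
        case False
        then obtain d where d: "k = q l * d" using dvd lr by (metis dvdE)
        have "d \<le> k" using d k_pos q_gt[of l] by (cases "q l") auto
        have "s + k = f l (r + d)" by (simp add: lr d f_def algebra_simps)
        then have "\<not> r + d < R" using s(2) lr by (auto simp: P_def)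
        then have "r \<in> {R - k..<R}" using lr \<open>d \<le> k\<close> by auto
        then show ?thesis using lr by blast
      qed
    qed
    then have "card {s \<in> P. s + k \<notin> P} \<le> card (f i ` {..<R} \<union> (\<Union>l<N. f l ` {R - k..<R}))"
      by (intro card_mono) auto
    also have "\<dots> \<le> card (f i ` {..<R}) + card (\<Union>l<N. f l ` {R - k..<R})" by (rule card_Un_le)
    also have "\<dots> \<le> R + (\<Sum>l<N. card (f l ` {R - k..<R}))"
      by (intro add_mono card_UN_le) (use card_image_le[of "{..<R}" "f i"] in auto)
    also have "\<dots> \<le> R + (\<Sum>l<N. k)"
    proof (intro add_left_mono sum_mono)
      fix l show "card (f l ` {R - k..<R}) \<le> k"
        using card_image_le[of "{R - k..<R}" "f l"] by simp
    qed
    also have "\<dots> \<le> R + N * Max F" using Max_ge[OF F_fin that] by simp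
    also have "\<dots> \<le> 2 * R" by (simp add: R_def)
    finally have "N * card {s \<in> P. s + k \<notin> P} \<le> N * (2 * R)" by (rule mult_left_mono) simp
    then show ?thesis using \<open>h \<le> k\<close> by (simp add: card_P mult.left_commute)
  qed
  have F_char: "norm (l - 1) \<le> real N * (2/3) ^ N"
    if l: "norm l = 1" "\<forall>k\<in>F. norm (l ^ k - 1) \<le> 1/2" for l :: complex
  proof (rule norm_power_int_minus_one_le[OF l(1) m_sum])
    fix i assume i: "i < N"
    show "norm (l ^ nat \<bar>m i\<bar> - 1) \<le> (2/3) ^ N"
    proof (cases "m i = 0")
      case False
      show ?thesis
      proof (rule dist_one_le_of_doubling)
        fix j assume "j \<le> N"
        then have "2 ^ j * nat \<bar>m i\<bar> \<in> F" using False i by (force simp: F_def)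
        then show "norm ((l ^ nat \<bar>m i\<bar>) ^ 2 ^ j - 1) \<le> 1/2"
          using l(2) by (simp add: power_mult[symmetric] mult.commute)
      qed
    qed simp
  qed
  have "cutting_step N \<delta> h (b N) P F"
    unfolding cutting_step_def
    using P_fin P2 P0 P_top P_sep bN_le F_fin F_ne F_good F_char by blast
  then show ?thesis using H_le by blast
qed

section \<open>The sequence of towers\<close>

text \<open>Here \<open>h0 k\<close> is the least height that \<open>exists_cutting_step\<close>
  admits for \<open>N = k + 2\<close> and \<open>\<delta> = (1/2) ^ (k + 2)\<close>, and its
  parameter \<open>H\<close> keeps the next height above \<open>h0 (Suc k)\<close>. The growing
  \<open>N\<close> sends the eigenvalue bound and the proportion of bad copies to 0, while the
  summable \<open>\<delta>\<close> keeps the total measure finite.\<close>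

lemma exists_cutting_sequence:
  "\<exists>h P F. \<forall>k. k < h k \<and> cutting_step (k + 2) ((1/2) ^ (k + 2)) (h k) (h (Suc k)) (P k) (F k)"
proof -
  define h0 where "h0 k = 2 ^ (k + 2) * (2 + fact (k + 2) * (k + 2) :: nat)" for k :: nat
  have h0_gt: "k < h0 k" for k
  proof -
    have "k < 2 ^ k" by (rule less_exp)
    also have "\<dots> \<le> h0 k" unfolding h0_def by (simp add: algebra_simps)
    finally show ?thesis .
  qed
  have "\<exists>h. \<forall>k. h0 k \<le> h k \<and> (\<exists>P F. cutting_step (k + 2) ((1/2) ^ (k + 2)) (h k) (h (Suc k)) P F)"
  proof (rule dependent_nat_choice)
    fix h k assume h: "h0 k \<le> h"
    have "real (2 + fact (k + 2) * (k + 2)) = (1/2) ^ (k + 2) * real (h0 k)"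
    proof -
      have "(1/2) ^ (k + 2) * (2 ^ (k + 2) * x) = x" for x :: real
        by (simp add: power_mult_distrib[symmetric] mult.assoc[symmetric] del: power_add power_Suc)
      then show ?thesis by (simp only: h0_def of_nat_mult of_nat_power of_nat_numeral)
    qed
    also have "\<dots> \<le> (1/2) ^ (k + 2) * real h" using h by (intro mult_left_mono) auto
    finally show "\<exists>h'. h0 (Suc k) \<le> h' \<and> (\<exists>P F. cutting_step (k + 2) ((1/2) ^ (k + 2)) h h' P F)"
      using exists_cutting_step[of "k + 2" h "(1/2) ^ (k + 2)" "h0 (Suc k)"] h0_gt[of k] h
      by auto
  qed auto
  then obtain h where h: "\<And>k. h0 k \<le> h k"
    and "\<And>k. \<exists>P F. cutting_step (k + 2) ((1/2) ^ (k + 2)) (h k) (h (Suc k)) P F"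
    by blast
  then obtain P F where "\<And>k. cutting_step (k + 2) ((1/2) ^ (k + 2)) (h k) (h (Suc k)) (P k) (F k)"
    by metis
  moreover have "k < h k" for k using h0_gt[of k] h[of k] by (rule order_less_le_trans)
  ultimately show ?thesis by blast
qed

text \<open>The complements of domain and image have equal cardinality. In the layout of a tower
  this places the spacers in the slots that the copies leave free.\<close>

lemma bij_betw_extend_finite:
  assumes "finite U" "A \<subseteq> U" "inj_on f A" "f ` A \<subseteq> U"
  shows "\<exists>g. bij_betw g U U \<and> (\<forall>x\<in>A. g x = f x)"
proof -
  have "card (U - A) = card (U - f ` A)"
    using assms by (simp add: card_Diff_subset card_image finite_subset)
  then obtain e where e: "bij_betw e (U - A) (U - f ` A)"
    using assms(1) by (metis finite_Diff finite_same_card_bij)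
  define g where "g x = (if x \<in> A then f x else e x)" for x
  have "bij_betw g A (f ` A)" "bij_betw g (U - A) (U - f ` A)"
    using assms(3) e by (auto simp: g_def bij_betw_def inj_on_def image_def cong: bij_betw_cong)
  from bij_betw_combine[OF this] have "bij_betw g (A \<union> (U - A)) (f ` A \<union> (U - f ` A))" by auto
  moreover have "A \<union> (U - A) = U" "f ` A \<union> (U - f ` A) = U" using assms by auto
  ultimately show ?thesis by (auto simp: g_def intro!: exI[of _ g])
qed

lemma inj_on_shifted_blocks:
  fixes P :: "nat set"
  assumes "\<forall>s\<in>P. \<forall>s'\<in>P. s < s' \<longrightarrow> s + h \<le> s'"
  shows "inj_on (\<lambda>(s, a). s + a) (P \<times> {..<h})"
proof (intro inj_onI, clarsimp)
  fix s a t b assume "s \<in> P" "t \<in> P" "a < h" "b < h" "s + a = t + b"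
  moreover from this have "\<not> s < t" "\<not> t < s" using assms by fastforce+
  ultimately show "s = t \<and> a = b" by simp
qed

lemma card_shifted_blocks_le:
  fixes P :: "nat set"
  assumes "\<forall>s\<in>P. \<forall>s'\<in>P. s < s' \<longrightarrow> s + h \<le> s'" "\<forall>s\<in>P. s + h < h'"
  shows "card P * h \<le> h'"
proof -
  have "card P * h = card ((\<lambda>(s, a). s + a) ` (P \<times> {..<h}))"
    using inj_on_shifted_blocks[OF assms(1)] by (simp add: card_image card_cartesian_product)
  also have "\<dots> \<le> card {..<h'}" using assms(2) by (intro card_mono) fastforce+
  finally show ?thesis by simp
qed

text \<open>On the copies the formula for \<open>g'\<close> is a number written with leading part
  \<open>g a\<close> and last digit \<open>rk s\<close> in base \<open>card P\<close>, hence
  injective. The spacers fill the remaining slots arbitrarily.\<close>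

lemma exists_layout_step:
  fixes P :: "nat set"
  assumes sep: "\<forall>s\<in>P. \<forall>s'\<in>P. s < s' \<longrightarrow> s + h \<le> s'"
    and top: "\<forall>s\<in>P. s + h < h'"
    and g: "bij_betw g {..<h} {..<h}" and rk: "bij_betw rk P {..<card P}"
  shows "\<exists>g'. bij_betw g' {..<h'} {..<h'} \<and> (\<forall>s\<in>P. \<forall>a<h. g' (s + a) = g a * card P + rk s)"
proof -
  let ?e = "\<lambda>(s, a). s + a" and ?D = "P \<times> {..<h}"
  have inj: "inj_on ?e ?D" by (rule inj_on_shifted_blocks[OF sep])
  define f where "f = (\<lambda>(s, a). g a * card P + rk s) \<circ> the_inv_into ?D ?e"
  have f: "f (s + a) = g a * card P + rk s" if "s \<in> P" "a < h" for s a
    using the_inv_into_f_f[OF inj, of "(s, a)"] that by (simp add: f_def)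
  have rk_lt: "rk s < card P" if "s \<in> P" for s using rk that by (auto simp: bij_betw_def)
  have "inj_on f (?e ` ?D)"
  proof (intro inj_onI, clarsimp simp: f)
    fix s a t b
    assume *: "s \<in> P" "t \<in> P" "a < h" "b < h" "g a * card P + rk s = g b * card P + rk t"
    have "(x * card P + rk u) mod card P = rk u" if "u \<in> P" for x u using rk_lt[OF that] by simp
    then have "rk s = rk t" using * by metis
    moreover from this have "g a = g b" using * rk_lt[of s] by auto
    ultimately show "s + a = t + b"
      using * bij_betw_imp_inj_on[OF g] bij_betw_imp_inj_on[OF rk] by (auto dest: inj_onD)
  qed
  moreover have "f ` ?e ` ?D \<subseteq> {..<h'}"
  proof (clarsimp simp: f)
    fix s a assume *: "s \<in> P" "a < h"
    then have "g a + 1 \<le> h" using bij_betw_apply[OF g, of a] by simp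
    then have "(g a + 1) * card P \<le> h * card P" by (rule mult_right_mono) simp
    also have "\<dots> \<le> h'" using card_shifted_blocks_le[OF sep top] by (simp add: mult.commute)
    finally show "g a * card P + rk s < h'" using rk_lt[OF *(1)] by simp
  qed
  moreover have "?e ` ?D \<subseteq> {..<h'}" using top by fastforce
  ultimately obtain g' where "bij_betw g' {..<h'} {..<h'}" "\<forall>x\<in>?e ` ?D. g' x = f x"
    using bij_betw_extend_finite[of "{..<h'}" "?e ` ?D" f] by auto
  then show ?thesis using f by (intro exI[of _ g']) force
qed

text \<open>
  The tower \<open>k\<close> consists of \<open>h k\<close> intervals of length \<open>w k\<close> inside \<open>[0, 1)\<close>, the level \<open>a\<close> being the
  interval number \<open>pl k a\<close> from the left; the copy of the tower starting at \<open>s \<in> P k\<close> takes the piece number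
  \<open>rk k s\<close> of each of these intervals.
\<close>

locale cut_stack =
  fixes h :: "nat \<Rightarrow> nat" and P :: "nat \<Rightarrow> nat set" and w :: "nat \<Rightarrow> real"
    and pl :: "nat \<Rightarrow> nat \<Rightarrow> nat" and rk :: "nat \<Rightarrow> nat \<Rightarrow> nat"
  assumes h_pos: "0 < h k" and P_fin: "finite (P k)" and P_card: "2 \<le> card (P k)" and P_pos: "0 \<notin> P k"
    and P_top: "s \<in> P k \<Longrightarrow> s + h k < h (Suc k)"
    and P_sep: "\<forall>s\<in>P k. \<forall>s'\<in>P k. s < s' \<longrightarrow> s + h k \<le> s'"
    and w_pos: "0 < w k" and w_Suc: "w k = real (card (P k)) * w (Suc k)"
    and w_lim: "(\<lambda>k. real (h k) * w k) \<longlonglongrightarrow> 1"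
    and pl_bij: "bij_betw (pl k) {..<h k} {..<h k}"
    and rk_bij: "bij_betw (rk k) (P k) {..<card (P k)}"
    and pl_Suc: "s \<in> P k \<Longrightarrow> a < h k \<Longrightarrow> pl (Suc k) (s + a) = pl k a * card (P k) + rk k s"

text \<open>Cutting alone would give width \<open>1 / d k\<close>. The resulting total lengths
  \<open>C k\<close> increase, because copies are disjoint, and stay bounded, because the
  proportions of spacers are summable. Dividing by their limit \<open>c\<close> normalizes the space
  to length 1.\<close>

lemma exists_cut_stack:
  assumes step: "\<And>k. cutting_step (k + 2) ((1/2) ^ (k + 2)) (h k) (h (Suc k)) (P k) (F k)" and h_pos: "\<And>k. 0 < h k"
  shows "\<exists>w pl rk. cut_stack h P w pl rk"
proof -
  have st: "finite (P k)" "2 \<le> card (P k)" "0 \<notin> P k" "\<forall>s\<in>P k. s + h k < h (Suc k)"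
    "\<forall>s\<in>P k. \<forall>s'\<in>P k. s < s' \<longrightarrow> s + h k \<le> s'"
    "real (h (Suc k)) \<le> real (card (P k)) * (real (h k) * (1 + (1/2) ^ (k + 2)))" for k
    using step[of k] by (auto simp: cutting_step_def)
  obtain rk where rk: "\<And>k. bij_betw (rk k) (P k) {..<card (P k)}"
  proof -
    have "\<forall>k. \<exists>r. bij_betw r (P k) {..<card (P k)}"
      using st(1) ex_bij_betw_finite_nat by (auto simp: atLeast0LessThan)
    then show ?thesis using that by metis
  qed
  have "\<exists>pl. \<forall>k. bij_betw (pl k) {..<h k} {..<h k} \<and>
      (\<forall>s\<in>P k. \<forall>a<h k. pl (Suc k) (s + a) = pl k a * card (P k) + rk k s)"
  proof (rule dependent_nat_choice)
    show "\<exists>g. bij_betw g {..<h 0} {..<h 0}" by (rule exI[of _ id]) simp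
    show "\<exists>g'. bij_betw g' {..<h (Suc k)} {..<h (Suc k)} \<and>
        (\<forall>s\<in>P k. \<forall>a<h k. g' (s + a) = g a * card (P k) + rk k s)"
      if "bij_betw g {..<h k} {..<h k}" for g k
      by (rule exists_layout_step[OF st(5) st(4) that rk])
  qed
  then obtain pl where pl: "\<And>k. bij_betw (pl k) {..<h k} {..<h k}"
    "\<And>k s a. s \<in> P k \<Longrightarrow> a < h k \<Longrightarrow> pl (Suc k) (s + a) = pl k a * card (P k) + rk k s"
    by blast
  define d where "d k = (\<Prod>i<k. real (card (P i)))" for k
  have card_pos: "0 < real (card (P k))" for k using st(2)[of k] by simp
  then have d_pos: "0 < d k" for k by (simp add: d_def prod_pos)
  have d_Suc: "d (Suc k) = d k * real (card (P k))" for k by (simp add: d_def)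
  define C where "C k = real (h k) / d k" for k
  have C_pos: "0 < C k" for k using h_pos d_pos by (simp add: C_def)
  have "incseq C"
  proof (rule incseq_SucI)
    fix k
    have "real (card (P k)) * real (h k) \<le> real (h (Suc k))"
      using card_shifted_blocks_le[OF st(5) st(4), of k] by (metis of_nat_le_iff of_nat_mult)
    then show "C k \<le> C (Suc k)"
      using card_pos[of k] d_pos[of k] by (simp add: C_def d_Suc field_simps)
  qed
  have C_Suc: "C (Suc k) \<le> C k * (1 + (1/2) ^ (k + 2))" for k
    using st(6)[of k] card_pos[of k] d_pos[of k] by (simp add: C_def d_Suc field_simps)
  \<comment> \<open>The correcting factor closes the induction since
    \<open>(1 - x) * (1 + x / 2) \<le> 1 - x / 2\<close>; at 0 the bound is exactly
    \<open>C 0\<close>.\<close>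
  have C_le: "C k \<le> 2 * C 0 * (1 - (1/2) ^ (k + 1))" for k
  proof (induction k)
    case (Suc k)
    define x :: real where "x = (1/2) ^ (k + 1)"
    have "C (Suc k) \<le> C k * (1 + x / 2)" using C_Suc[of k] by (simp add: x_def)
    also have "\<dots> \<le> 2 * C 0 * (1 - x) * (1 + x / 2)"
      using Suc by (intro mult_right_mono) (auto simp: x_def)
    also have "\<dots> = 2 * C 0 * (1 - x / 2 - x\<^sup>2 / 2)"
      by (simp add: power2_eq_square algebra_simps)
    also have "\<dots> \<le> 2 * C 0 * (1 - x / 2)"
      using C_pos[of 0] by (intro mult_left_mono) auto
    finally show ?case by (simp add: x_def)
  qed simp
  have "C k \<le> 2 * C 0" for k
  proof -
    have "2 * C 0 * (1 - (1/2) ^ (k + 1)) \<le> 2 * C 0 * 1"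
      using C_pos[of 0] by (intro mult_left_mono) auto
    then show ?thesis using C_le[of k] by simp
  qed
  then obtain c where c: "C \<longlonglongrightarrow> c" "\<And>k. C k \<le> c"
    using incseq_convergent[OF \<open>incseq C\<close>] by metis
  have c_pos: "0 < c" using c(2)[of 0] C_pos[of 0] by simp
  define w where "w k = 1 / (c * d k)" for k
  have "(\<lambda>k. C k / c) \<longlonglongrightarrow> c / c" using c c_pos by (intro tendsto_intros) auto
  moreover have "C k / c = real (h k) * w k" for k by (simp add: C_def w_def)
  ultimately have "(\<lambda>k. real (h k) * w k) \<longlonglongrightarrow> 1" using c_pos by simp
  moreover have "0 < w k" "w k = real (card (P k)) * w (Suc k)" for k
    using c_pos d_pos[of k] card_pos[of k] by (auto simp: w_def d_Suc)
  ultimately have "cut_stack h P w pl rk"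
  proof unfold_locales
    fix k
    show "0 < h k" by (rule h_pos)
    show "finite (P k)" "2 \<le> card (P k)" "0 \<notin> P k" using st(1-3) by auto
    show "s + h k < h (Suc k)" if "s \<in> P k" for s using st(4) that by blast
  qed (rule st(5) pl(1) pl(2) rk | assumption)+
  then show ?thesis by blast
qed

section \<open>The rank-one transformation\<close>

lemma floor_bounds:
  fixes x v :: real
  assumes "0 \<le> x" "0 < v"
  shows "real (nat \<lfloor>x / v\<rfloor>) * v \<le> x" "x < (real (nat \<lfloor>x / v\<rfloor>) + 1) * v"
proof -
  have "real (nat \<lfloor>x / v\<rfloor>) = of_int \<lfloor>x / v\<rfloor>" using assms by simp
  then have "real (nat \<lfloor>x / v\<rfloor>) \<le> x / v" "x / v < real (nat \<lfloor>x / v\<rfloor>) + 1" by linarith+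
  then show "real (nat \<lfloor>x / v\<rfloor>) * v \<le> x" "x < (real (nat \<lfloor>x / v\<rfloor>) + 1) * v"
    by (simp_all only: pos_le_divide_eq[OF assms(2)] pos_divide_less_eq[OF assms(2)])
qed

section \<open>Levels of the towers and their refinement\<close>

context cut_stack
begin

text \<open>Half-open intervals make the levels of a tower disjoint and their splitting exact, with
  no exceptional null set.\<close>

definition lev :: "nat \<Rightarrow> nat \<Rightarrow> real set" where
  "lev k a = {real (pl k a) * w k ..< (real (pl k a) + 1) * w k}"

text \<open>Meaningful only for \<open>a + 1 < h k\<close>, since the locale fixes
  \<open>pl k\<close> only below \<open>h k\<close>.\<close>

definition tr :: "nat \<Rightarrow> nat \<Rightarrow> real" where
  "tr k a = (real (pl k (a + 1)) - real (pl k a)) * w k"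

lemma card_P_pos: "0 < card (P k)"
  using P_card[of k] by simp

lemma lev_Suc_subset:
  assumes "s \<in> P k" "a < h k"
  shows "lev (Suc k) (s + a) \<subseteq> lev k a"
proof -
  let ?v = "w (Suc k)" and ?n = "pl k a" and ?p = "card (P k)"
  have rk: "rk k s + 1 \<le> ?p" using bij_betw_apply[OF rk_bij assms(1)] by simp
  have v: "0 \<le> ?v" using w_pos[of "Suc k"] by simp
  have "real ?n * w k \<le> real (?n * ?p + rk k s) * ?v"
    using v by (simp add: w_Suc[of k] algebra_simps)
  moreover have "(real (?n * ?p + rk k s) + 1) * ?v \<le> (real ?n + 1) * w k"
  proof -
    have "real (?n * ?p + rk k s) + 1 \<le> real ((?n + 1) * ?p)" using rk by (simp add: algebra_simps)
    then have "(real (?n * ?p + rk k s) + 1) * ?v \<le> real ((?n + 1) * ?p) * ?v"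
      using v by (rule mult_right_mono)
    then show ?thesis by (simp add: w_Suc[of k] algebra_simps)
  qed
  ultimately show ?thesis
    by (simp add: lev_def pl_Suc[OF assms])
qed

lemma lev_step:
  assumes "x \<in> lev k a" "a < h k"
  shows "\<exists>s\<in>P k. x \<in> lev (Suc k) (s + a)"
proof -
  let ?v = "w (Suc k)" and ?n = "pl k a" and ?p = "card (P k)"
  have v: "0 < ?v" using w_pos by simp
  have x: "real ?n * w k \<le> x" "x < (real ?n + 1) * w k" using assms by (auto simp: lev_def)
  have "0 \<le> real ?n * w k" using w_pos[of k] by simp
  then have "0 \<le> x" using x by linarith
  \<comment> \<open>\<open>i\<close> is the number of the cell of width \<open>w (Suc k)\<close>
    that contains \<open>x\<close>. The two bounds on it say that its leading part in base
    \<open>card (P k)\<close> is \<open>pl k a\<close>, so its last digit is the rank of the copy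
    sought.\<close>
  define i where "i = nat \<lfloor>x / ?v\<rfloor>"
  have i: "real i * ?v \<le> x" "x < (real i + 1) * ?v"
    unfolding i_def by (rule floor_bounds[OF \<open>0 \<le> x\<close> v])+
  have "real (?n * ?p) * ?v < (real i + 1) * ?v"
    using x i by (simp add: w_Suc[of k] mult.assoc)
  then have "real (?n * ?p) < real i + 1" unfolding mult_less_cancel_right_pos[OF v] .
  then have 1: "?n * ?p \<le> i" by linarith
  have "real i * ?v < real ((?n + 1) * ?p) * ?v"
    using x i by (simp add: w_Suc[of k] algebra_simps)
  then have 2: "i < (?n + 1) * ?p" unfolding mult_less_cancel_right_pos[OF v] of_nat_less_iff .
  from 1 2 have "i - ?n * ?p < ?p" by (simp add: less_diff_conv2 algebra_simps)
  then obtain s where s: "s \<in> P k" "rk k s = i - ?n * ?p"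
    using bij_betw_imp_surj_on[OF rk_bij, of k] by (metis imageE lessThan_iff)
  then have "pl (Suc k) (s + a) = i" using 1 by (simp add: pl_Suc assms)
  then show ?thesis using i s by (auto simp: lev_def)
qed

lemma lev_split: "a < h k \<Longrightarrow> lev k a = (\<Union>s\<in>P k. lev (Suc k) (s + a))"
  by (auto dest: lev_step subsetD[OF lev_Suc_subset])

lemma lev_unique:
  assumes "x \<in> lev k a" "x \<in> lev k b" "a < h k" "b < h k"
  shows "a = b"
proof -
  have "real (pl k a) * w k < (real (pl k b) + 1) * w k" "real (pl k b) * w k < (real (pl k a) + 1) * w k"
    using assms by (auto simp: lev_def)
  then have "real (pl k a) < real (pl k b) + 1" "real (pl k b) < real (pl k a) + 1"
    unfolding mult_less_cancel_right_pos[OF w_pos] .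
  then have "pl k a = pl k b" by linarith
  then show ?thesis using bij_betw_imp_inj_on[OF pl_bij] assms by (auto dest: inj_onD)
qed

lemma incseq_total: "incseq (\<lambda>k. real (h k) * w k)"
proof (rule incseq_SucI)
  fix k
  have "card (P k) * h k \<le> h (Suc k)"
    using P_sep P_top by (intro card_shifted_blocks_le) auto
  then have "real (card (P k) * h k) * w (Suc k) \<le> real (h (Suc k)) * w (Suc k)"
    using w_pos[of "Suc k"] by (intro mult_right_mono of_nat_mono) auto
  then show "real (h k) * w k \<le> real (h (Suc k)) * w (Suc k)"
    by (simp add: w_Suc[of k] algebra_simps)
qed

lemma total_le_one: "real (h k) * w k \<le> 1"
  using incseq_le[OF incseq_total w_lim] .

lemma lev_subset: "a < h k \<Longrightarrow> lev k a \<subseteq> {0..<1}"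
proof -
  assume "a < h k"
  then have "pl k a + 1 \<le> h k" using bij_betw_apply[OF pl_bij, of a k] by simp
  then have "real (pl k a + 1) * w k \<le> real (h k) * w k"
    using w_pos[of k] by (intro mult_right_mono of_nat_mono) auto
  also have "\<dots> \<le> 1" by (rule total_le_one)
  finally have "(real (pl k a) + 1) * w k \<le> 1" by (simp add: add.commute)
  moreover have "0 \<le> real (pl k a) * w k" using w_pos[of k] by simp
  ultimately show ?thesis unfolding lev_def by auto
qed

text \<open>The levels of tower \<open>k\<close> fill exactly the interval from 0 to
  \<open>h k * w k\<close>, whose right end tends to 1.\<close>

lemma lev_cover:
  assumes "x \<in> {0..<1}"
  shows "\<exists>k a. a < h k \<and> x \<in> lev k a"
proof -
  have "eventually (\<lambda>k. x < real (h k) * w k) sequentially"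
    using w_lim assms by (intro order_tendstoD(1)) auto
  then obtain k where k: "x < real (h k) * w k" using eventually_happens'[OF sequentially_bot] by blast
  define i where "i = nat \<lfloor>x / w k\<rfloor>"
  have i: "real i * w k \<le> x" "x < (real i + 1) * w k"
    unfolding i_def using floor_bounds assms w_pos[of k] by auto
  then have "real i * w k < real (h k) * w k" using k by linarith
  then have "i < h k" unfolding mult_less_cancel_right_pos[OF w_pos] of_nat_less_iff .
  then obtain a where "a < h k" "pl k a = i"
    using bij_betw_imp_surj_on[OF pl_bij, of k] by (metis imageE lessThan_iff)
  then show ?thesis using i unfolding lev_def by (intro exI[of _ k] exI[of _ a]) simp
qed

text \<open>\<open>P_pos\<close> and \<open>P_top\<close> move a point off the bottom and the top as
  soon as one more tower is built. The displacement persists because two consecutive levels are cut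
  in the same way within each copy: the ranks cancel in the difference.\<close>

lemma lev_later:
  assumes "x \<in> lev k a" "a < h k" "k < k'"
  shows "\<exists>b. 0 < b \<and> b + 1 < h k' \<and> x \<in> lev k' b \<and> lev k' b \<subseteq> lev k a \<and>
           (a + 1 < h k \<longrightarrow> tr k' b = tr k a)"
proof -
  have later: "\<exists>b. 0 < b \<and> b + 1 < h (Suc j) \<and> x \<in> lev (Suc j) b \<and> lev (Suc j) b \<subseteq> lev j a \<and>
           (a + 1 < h j \<longrightarrow> tr (Suc j) b = tr j a)" if a: "x \<in> lev j a" "a < h j" for j a
  proof -
    obtain s where s: "s \<in> P j" "x \<in> lev (Suc j) (s + a)" using lev_step[OF a] by blast
    have "0 < s" using s(1) P_pos[of j] by (cases s) auto
    moreover have "s + a + 1 < h (Suc j)" using P_top[OF s(1)] a by linarith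
    moreover have "tr (Suc j) (s + a) = tr j a" if "a + 1 < h j"
      using pl_Suc[OF s(1), of "a + 1"] pl_Suc[OF s(1), of a] that
      by (simp add: tr_def w_Suc[of j] algebra_simps)
    ultimately show ?thesis using s lev_Suc_subset[OF s(1) a(2)] by (intro exI[of _ "s + a"]) auto
  qed
  have "Suc k \<le> k'" using assms(3) by simp
  then show ?thesis
  proof (induction k' rule: dec_induct)
    case base
    then show ?case using later[OF assms(1,2)] .
  next
    case (step n)
    then obtain b where b: "b + 1 < h n" "x \<in> lev n b" "lev n b \<subseteq> lev k a"
      "a + 1 < h k \<longrightarrow> tr n b = tr k a"
      by blast
    obtain c where "0 < c" "c + 1 < h (Suc n)" "x \<in> lev (Suc n) c" "lev (Suc n) c \<subseteq> lev n b"
      "tr (Suc n) c = tr n b"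
      using later[of n b] b by auto
    then show ?case using b by (intro exI[of _ c]) auto
  qed
qed

section \<open>The limit transformation and its inverse\<close>

lemma tr_unique:
  assumes "x \<in> lev k a" "a + 1 < h k" "x \<in> lev j b" "b + 1 < h j"
  shows "tr k a = tr j b"
proof -
  obtain K where K: "k < K" "j < K" by (metis gt_ex max_less_iff_conj)
  obtain c where c: "c + 1 < h K" "x \<in> lev K c" "tr K c = tr k a"
    using lev_later[OF assms(1) _ K(1)] assms(2) by auto
  obtain d where d: "d + 1 < h K" "x \<in> lev K d" "tr K d = tr j b"
    using lev_later[OF assms(3) _ K(2)] assms(4) by auto
  have "c = d" using lev_unique[OF c(2) d(2)] c d by simp
  then show ?thesis using c d by simp
qed

text \<open>All towers in which \<open>x\<close> lies below the top prescribe the same value by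
  \<open>tr_unique\<close>, so the choice is determined on the unit interval; \<open>T_eq\<close> is
  the form in which it is used.\<close>

definition T :: "real \<Rightarrow> real" where
  "T x = (SOME y. \<forall>k a. a + 1 < h k \<longrightarrow> x \<in> lev k a \<longrightarrow> y = x + tr k a)"

lemma T_eq:
  assumes "x \<in> lev k a" "a + 1 < h k"
  shows "T x = x + tr k a"
proof -
  have "\<forall>j b. b + 1 < h j \<longrightarrow> x \<in> lev j b \<longrightarrow> x + tr k a = x + tr j b"
    using tr_unique[OF assms] by simp
  then have "\<forall>j b. b + 1 < h j \<longrightarrow> x \<in> lev j b \<longrightarrow> T x = x + tr j b"
    unfolding T_def by (rule someI)
  then show ?thesis using assms by blast
qed

lemma lev_translate: "x \<in> lev k a \<longleftrightarrow> x + tr k a \<in> lev k (a + 1)"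
  by (simp add: lev_def tr_def algebra_simps)

lemma T_lev: "x \<in> lev k a \<Longrightarrow> a + 1 < h k \<Longrightarrow> T x \<in> lev k (a + 1)"
  using T_eq lev_translate by metis

lemma T_preimage:
  assumes "y \<in> lev k (a + 1)" "a + 1 < h k"
  shows "y - tr k a \<in> lev k a" "T (y - tr k a) = y"
proof -
  show "y - tr k a \<in> lev k a" using assms(1) lev_translate[of "y - tr k a" k a] by simp
  from T_eq[OF this assms(2)] show "T (y - tr k a) = y" by simp
qed

lemma lev_cover_later:
  assumes "x \<in> {0..<1}"
  shows "\<exists>k. \<forall>k'>k. \<exists>b. 0 < b \<and> b + 1 < h k' \<and> x \<in> lev k' b"
  using lev_cover[OF assms] lev_later by meson

text \<open>Two points lie in one common late tower, both below its top. Equal images force equal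
  levels there, and on a single level \<open>T\<close> is a translation.\<close>

lemma T_inj: "inj_on T {0..<1}"
proof (rule inj_onI)
  fix x y :: real assume xy: "x \<in> {0..<1}" "y \<in> {0..<1}" "T x = T y"
  obtain i where i: "\<And>k. i < k \<Longrightarrow> \<exists>b. 0 < b \<and> b + 1 < h k \<and> x \<in> lev k b"
    using lev_cover_later[OF xy(1)] by blast
  obtain j where j: "\<And>k. j < k \<Longrightarrow> \<exists>b. 0 < b \<and> b + 1 < h k \<and> y \<in> lev k b"
    using lev_cover_later[OF xy(2)] by blast
  obtain k where k: "i < k" "j < k" by (metis gt_ex max_less_iff_conj)
  obtain b where b: "b + 1 < h k" "x \<in> lev k b" using i[OF k(1)] by blast
  obtain c where c: "c + 1 < h k" "y \<in> lev k c" using j[OF k(2)] by blast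
  have "T x \<in> lev k (b + 1)" "T x \<in> lev k (c + 1)"
    using T_lev[OF b(2,1)] T_lev[OF c(2,1)] xy(3) by simp_all
  then have "b + 1 = c + 1" using b c by (intro lev_unique) auto
  then show "x = y" using T_eq b c xy(3) by force
qed

text \<open>Every point lies above the bottom of some tower, hence is the image of a point one level
  lower.\<close>

lemma T_surj: "T ` {0..<1} = {0..<1}"
proof (intro equalityI subsetI)
  fix y assume "y \<in> T ` {0..<1}"
  then obtain x where x: "x \<in> {0..<1}" "y = T x" by blast
  then obtain k b where "b + 1 < h k" "x \<in> lev k b" using lev_cover_later by (meson lessI)
  then show "y \<in> {0..<1}" using T_lev lev_subset x by blast
next
  fix y :: real assume "y \<in> {0..<1}"
  then obtain k b where b: "0 < b" "b + 1 < h k" "y \<in> lev k b"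
    using lev_cover_later by (meson lessI)
  then obtain a where a: "b = a + 1" by (cases b) auto
  have "y - tr k a \<in> lev k a" "T (y - tr k a) = y" using T_preimage[of y k a] b a by auto
  moreover have "lev k a \<subseteq> {0..<1}" using lev_subset a b by simp
  ultimately show "y \<in> T ` {0..<1}" by (metis image_eqI subsetD)
qed

lemma T_in: "x \<in> {0..<1} \<Longrightarrow> T x \<in> {0..<1}"
  using T_surj by blast

text \<open>Injectivity gives the converse of \<open>T_lev\<close>: the point of
  \<open>lev k a\<close> that is mapped to \<open>T x\<close> must be \<open>x\<close>. This
  identifies preimages of levels exactly.\<close>

lemma T_lev_iff:
  assumes "x \<in> {0..<1}" "a + 1 < h k"
  shows "T x \<in> lev k (a + 1) \<longleftrightarrow> x \<in> lev k a"
proof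
  assume *: "T x \<in> lev k (a + 1)"
  have "T x - tr k a \<in> lev k a" "T (T x - tr k a) = T x" using T_preimage[OF * assms(2)] by auto
  moreover have "T x - tr k a \<in> {0..<1}" using calculation(1) lev_subset[of a k] assms(2) by auto
  ultimately show "x \<in> lev k a" using T_inj assms(1) by (metis inj_onD)
qed (use T_lev assms in blast)

lemma T_lev_image:
  assumes "a + 1 < h k"
  shows "T ` lev k a = lev k (a + 1)"
proof (intro equalityI subsetI)
  fix y assume "y \<in> lev k (a + 1)"
  from T_preimage[OF this assms] show "y \<in> T ` lev k a" by (metis image_eqI)
qed (use T_lev assms in blast)

lemma T_funpow_lev: "x \<in> lev k a \<Longrightarrow> a + m < h k \<Longrightarrow> (T ^^ m) x \<in> lev k (a + m)"
proof (induction m)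
  case (Suc m)
  then show ?case using T_lev[of "(T ^^ m) x" k "a + m"] by simp
qed simp

text \<open>Each step cuts every level into at least two pieces, so the widths at least
  halve.\<close>

lemma w_tendsto_zero: "w \<longlonglongrightarrow> 0"
proof -
  have "w k \<le> w 0 * (1/2) ^ k" for k
  proof (induction k)
    case (Suc k)
    have "2 * w (Suc k) \<le> real (card (P k)) * w (Suc k)"
      using w_pos[of "Suc k"] P_card[of k] by (intro mult_right_mono) auto
    then show ?case using Suc w_Suc[of k] by simp
  qed simp
  moreover have "(\<lambda>k. w 0 * (1/2) ^ k) \<longlonglongrightarrow> w 0 * 0"
    by (intro tendsto_intros LIMSEQ_realpow_zero) auto
  ultimately show ?thesis
    by (intro tendsto_sandwich[of "\<lambda>_. 0" w sequentially "\<lambda>k. w 0 * (1/2) ^ k" 0])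
      (auto intro!: always_eventually less_imp_le[OF w_pos])
qed

end

section \<open>The unit interval as a standard probability space\<close>

definition unit_interval_measure :: "real measure" where
  "unit_interval_measure = restrict_space lborel {0..<1}"

lemma space_unit_interval_measure [simp]: "space unit_interval_measure = {0..<1}"
  by (simp add: unit_interval_measure_def space_restrict_space)

lemma sets_unit_interval_measure:
  "sets unit_interval_measure = sigma_sets {0..<1} ((\<inter>) {0..<1} ` {U. open U})"
proof -
  have b: "sets borel = sigma_sets UNIV {U::real set. open U}"
    by (simp add: borel_def)
  have "{0..<1} \<in> sigma_sets UNIV {U::real set. open U}"
    unfolding b[symmetric] by simp
  then have "(\<inter>) {0..<1} ` sigma_sets UNIV {U::real set. open U} =
      sigma_sets {0..<1} ((\<inter>) {0..<1} ` {U. open U})"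
    by (rule sigma_sets_Int) simp
  then show ?thesis
    by (simp only: unit_interval_measure_def sets_restrict_space sets_lborel b)
qed

lemma sets_unit_interval_measureI:
  "A \<in> sets borel \<Longrightarrow> A \<subseteq> {0..<1} \<Longrightarrow> A \<in> sets unit_interval_measure"
  by (simp add: unit_interval_measure_def sets_restrict_space_iff)

lemma emeasure_unit_interval_measure:
  "A \<subseteq> {0..<1} \<Longrightarrow> emeasure unit_interval_measure A = emeasure lborel A"
  by (simp add: unit_interval_measure_def emeasure_restrict_space)

lemma prob_space_unit_interval_measure: "prob_space unit_interval_measure"
  by (rule prob_spaceI) (simp add: emeasure_unit_interval_measure)

lemma second_countable_euclidean:
  "second_countable (euclidean :: 'a::second_countable_topology topology)"
proof -
  obtain B :: "'a set set" where "countable B" "topological_basis B"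
    using ex_countable_basis by blast
  then show ?thesis
    unfolding second_countable_def
    by (intro exI[of _ B]) (auto simp: topological_basis_open intro: topological_basisE)
qed

text \<open>The half-open interval is not complete for the usual metric, but it is closed in the
  open set \<open>{..<1}\<close>, and complete metrizability passes to open and to closed
  subspaces.\<close>

lemma standard_borel_unit_interval_measure: "standard_borel unit_interval_measure"
  unfolding standard_borel_def
proof (intro exI conjI)
  let ?X = "subtopology euclideanreal {0..<1}"
  have "?X = subtopology (subtopology euclideanreal {..<1}) {0..}"
    by (simp add: subtopology_subtopology) (metis atLeastLessThan_def inf_commute)
  moreover have "completely_metrizable_space (subtopology euclideanreal {..<1::real})"
    by (intro completely_metrizable_space_openin completely_metrizable_space_euclidean) simp
  moreover have "closedin (subtopology euclideanreal {..<1}) ({..<1} \<inter> {0..})"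
    by (simp add: closedin_closed_Int)
  ultimately show "completely_metrizable_space ?X"
    by (metis completely_metrizable_space_closedin subtopology_restrict topspace_euclidean_subtopology)
  show "second_countable ?X"
    by (intro second_countable_subtopology second_countable_euclidean)
  show "topspace ?X = space unit_interval_measure" by simp
  have "{U. openin ?X U} = (\<inter>) {0..<1} ` {U. open U}"
    by (auto simp: openin_open)
  then show "sets unit_interval_measure = sigma_sets (space unit_interval_measure) {U. openin ?X U}"
    by (simp add: sets_unit_interval_measure)
qed


section \<open>Generating levels, invariance of the measure and non-atomicity\<close>

context cut_stack
begin

abbreviation M :: "real measure" where "M \<equiv> unit_interval_measure"

text \<open>Bottom and top levels are excluded so that the image and the preimage of a generator
  under \<open>T\<close> are again levels of the same tower.\<close>

definition gen :: "real set set" where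
  "gen = {lev k a | k a. 0 < a \<and> a + 1 < h k}"

lemma genI: "0 < a \<Longrightarrow> a + 1 < h k \<Longrightarrow> lev k a \<in> gen"
  by (auto simp: gen_def)

lemma countable_gen: "countable gen"
proof -
  have "gen \<subseteq> (\<lambda>(k, a). lev k a) ` UNIV" by (auto simp: gen_def)
  then show ?thesis by (rule countable_subset) simp
qed

lemma gen_subset: "gen \<subseteq> Pow {0..<1}"
proof
  fix A assume "A \<in> gen"
  then obtain k a where "A = lev k a" "a < h k" unfolding gen_def by force
  then show "A \<in> Pow {0..<1}" using lev_subset by blast
qed

lemma Union_gen: "\<Union>gen = {0..<1}"
proof
  show "{0..<1} \<subseteq> \<Union>gen"
  proof
    fix x :: real assume "x \<in> {0..<1}"
    then obtain k b where "0 < b" "b + 1 < h k" "x \<in> lev k b"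
      using lev_cover_later by (meson lessI)
    then show "x \<in> \<Union>gen" using genI by blast
  qed
qed (use gen_subset in blast)

text \<open>A level of a later tower is contained in every level of an earlier tower that it meets,
  by \<open>lev_later\<close>.\<close>

lemma lev_Int_cases:
  assumes "a < h k" "b < h j" "k \<le> j"
  shows "lev k a \<inter> lev j b = {} \<or> lev k a \<inter> lev j b = lev j b"
proof (cases "lev k a \<inter> lev j b = {}")
  case False
  then obtain x where x: "x \<in> lev k a" "x \<in> lev j b" by blast
  have "lev j b \<subseteq> lev k a"
  proof (cases "k = j")
    case True
    then show ?thesis using lev_unique x assms by blast
  next
    case False
    then obtain c where "c + 1 < h j" "x \<in> lev j c" "lev j c \<subseteq> lev k a"
      using lev_later[OF x(1) assms(1)] assms(3) by (metis le_neq_implies_less)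
    moreover from this have "c = b" using lev_unique x assms by (metis add_lessD1)
    ultimately show ?thesis by blast
  qed
  then show ?thesis by blast
qed simp

lemma Int_stable_gen: "Int_stable (insert {} gen)"
proof (rule Int_stableI)
  fix A B assume "A \<in> insert {} gen" "B \<in> insert {} gen"
  then consider "A = {}" | "B = {}" |
    k a j b where "A = lev k a" "B = lev j b" "a < h k" "b < h j" "A \<in> gen" "B \<in> gen"
    unfolding gen_def by fastforce
  then show "A \<inter> B \<in> insert {} gen"
  proof cases
    case 3
    then show ?thesis
      using lev_Int_cases[of a k b j] lev_Int_cases[of b j a k]
      by (metis inf_commute insert_iff nle_le)
  qed auto
qed

text \<open>A point lies in a generating level of every late tower, and the widths tend to 0. As
  \<open>gen\<close> is countable, it therefore generates the Borel sets.\<close>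

lemma open_Int_eq_Union_gen:
  fixes U :: "real set"
  assumes "open U"
  shows "{0..<1} \<inter> U = \<Union>{A \<in> gen. A \<subseteq> U}"
proof (intro equalityI subsetI)
  fix x assume x: "x \<in> {0..<1} \<inter> U"
  then obtain e where e: "0 < e" "ball x e \<subseteq> U" using assms open_contains_ball by blast
  obtain i where i: "\<And>k. i < k \<Longrightarrow> \<exists>b. 0 < b \<and> b + 1 < h k \<and> x \<in> lev k b"
    using lev_cover_later x by blast
  have "eventually (\<lambda>k. w k < e \<and> i < k) sequentially"
    using order_tendstoD(2)[OF w_tendsto_zero e(1)] eventually_gt_at_top by (rule eventually_conj)
  then obtain k where k: "w k < e" "i < k"
    using eventually_happens'[OF sequentially_bot] by blast
  obtain b where b: "0 < b" "b + 1 < h k" "x \<in> lev k b" using i[OF k(2)] by blast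
  have "lev k b \<subseteq> ball x e"
    using b(3) k(1) by (auto simp: lev_def dist_real_def algebra_simps)
  then show "x \<in> \<Union>{A \<in> gen. A \<subseteq> U}" using b genI e by blast
qed (use gen_subset in blast)

lemma lev_borel [measurable]: "lev k a \<in> sets borel"
  by (simp add: lev_def)

lemma lev_sets: "a < h k \<Longrightarrow> lev k a \<in> sets M"
  by (intro sets_unit_interval_measureI lev_borel lev_subset)

lemma gen_sets: "gen \<subseteq> sets M"
proof
  fix A assume "A \<in> gen"
  then obtain k a where "A = lev k a" "a < h k" unfolding gen_def by force
  then show "A \<in> sets M" using lev_sets by blast
qed

lemma sets_M: "sets M = sigma_sets {0..<1} (insert {} gen)"
proof
  show "sigma_sets {0..<1} (insert {} gen) \<subseteq> sets M"
    using sets.sigma_sets_subset[of "insert {} gen" M] gen_sets by simp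
  show "sets M \<subseteq> sigma_sets {0..<1} (insert {} gen)"
    unfolding sets_unit_interval_measure
  proof (rule sigma_sets_mono, rule subsetI)
    fix A :: "real set" assume "A \<in> (\<inter>) {0..<1} ` {U. open U}"
    then obtain U where "open U" "A = {0..<1} \<inter> U" by blast
    then have A: "A = \<Union>{A \<in> gen. A \<subseteq> U}" using open_Int_eq_Union_gen by simp
    have "countable {A \<in> gen. A \<subseteq> U}" using countable_gen by (rule countable_subset[rotated]) blast
    then show "A \<in> sigma_sets {0..<1} (insert {} gen)"
      unfolding A by (rule sigma_sets_UNION) (blast intro: sigma_sets.Basic)
  qed
qed

lemma emeasure_lev: "a < h k \<Longrightarrow> emeasure M (lev k a) = ennreal (w k)"
proof -
  assume a: "a < h k"
  have "real (pl k a) * w k \<le> (real (pl k a) + 1) * w k"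
    using w_pos[of k] by (intro mult_right_mono) auto
  then show ?thesis
    unfolding emeasure_unit_interval_measure[OF lev_subset[OF a]]
    unfolding lev_def by (simp add: algebra_simps)
qed

lemma measure_lev: "a < h k \<Longrightarrow> measure M (lev k a) = w k"
  using emeasure_lev[of a k] w_pos[of k] by (simp add: measure_def)

lemma T_vimage_lev: "a + 1 < h k \<Longrightarrow> T -` lev k (a + 1) \<inter> {0..<1} = lev k a"
  using T_lev_iff[of _ a k] lev_subset[of a k] by auto

lemma T_measurable: "T \<in> measurable M M"
proof (rule measurable_sigma_sets[OF sets_M])
  fix A assume "A \<in> insert {} gen"
  then consider "A = {}" | k a where "A = lev k a" "0 < a" "a + 1 < h k"
    by (auto simp: gen_def)
  then show "T -` A \<inter> space M \<in> sets M"
  proof cases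
    case 2
    then obtain b where "a = b + 1" by (cases a) auto
    then show ?thesis using 2 T_vimage_lev[of b k] lev_sets[of b k] by simp
  qed simp
qed (use gen_subset T_in in auto)

lemma T_inverse_measurable: "the_inv_into {0..<1} T \<in> measurable M M"
proof (rule measurable_sigma_sets[OF sets_M])
  show "the_inv_into {0..<1} T \<in> space M \<rightarrow> {0..<1}"
    using the_inv_into_into[OF T_inj, of _ "{0..<1}"] T_surj by auto
  fix A assume "A \<in> insert {} gen"
  then consider "A = {}" | k a where "A = lev k a" "a + 1 < h k"
    by (auto simp: gen_def)
  then show "the_inv_into {0..<1} T -` A \<inter> space M \<in> sets M"
  proof cases
    case 2
    have "the_inv_into {0..<1} T -` A \<inter> T ` {0..<1} = T ` A"
      using 2 lev_subset[of a k] by (intro the_inv_into_vimage[OF T_inj]) auto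
    then show ?thesis using 2 T_lev_image[of a k] lev_sets[of "a + 1" k] by (simp add: T_surj)
  qed simp
qed (use gen_subset in auto)

text \<open>The preimage of a generator is a level of the same width, and the generators together
  with the empty set are stable under intersection.\<close>

lemma distr_T: "distr M M T = M"
proof (rule measure_eqI_generator_eq_countable[OF Int_stable_gen, where \<Omega> = "{0..<1}" and A = "insert {} gen"])
  show "emeasure (distr M M T) A = emeasure M A" if "A \<in> insert {} gen" for A
  proof -
    from that consider "A = {}" | k a where "A = lev k a" "0 < a" "a + 1 < h k"
      by (auto simp: gen_def)
    then show ?thesis
    proof cases
      case 2
      then obtain b where "a = b + 1" by (cases a) auto
      then show ?thesis
        using 2 T_vimage_lev[of b k] lev_sets[of a k] emeasure_lev[of a k] emeasure_lev[of b k]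
        by (simp add: emeasure_distr T_measurable)
    qed simp
  qed
  show "emeasure (distr M M T) a \<noteq> \<infinity>" for a
  proof -
    interpret prob_space "distr M M T"
      using prob_space.prob_space_distr[OF prob_space_unit_interval_measure T_measurable] .
    show ?thesis by simp
  qed
qed (use gen_subset countable_gen Union_gen sets_M in auto)

lemma invertible_pmp_system_T: "invertible_pmp_system M T"
  unfolding invertible_pmp_system_def invertible_mp_def
  using T_inj T_surj T_measurable T_inverse_measurable distr_T prob_space_unit_interval_measure
  by (simp add: bij_betw_def)

lemma non_atomic_M: "non_atomic M"
  unfolding non_atomic_def
proof (intro ballI impI)
  interpret prob_space M by (rule prob_space_unit_interval_measure)
  fix A assume A: "A \<in> sets M" "0 < emeasure M A"
  then have pos: "0 < measure M A" by (simp add: emeasure_eq_measure)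
  \<comment> \<open>A tower is chosen that misses less than the measure of \<open>A\<close> and
    whose levels are thinner than \<open>A\<close>. Some level then meets \<open>A\<close> in
    positive but strictly smaller measure.\<close>
  have "(\<lambda>k. 1 - real (h k) * w k) \<longlonglongrightarrow> 1 - 1"
    by (intro tendsto_intros w_lim)
  then have "eventually (\<lambda>k. 1 - real (h k) * w k < measure M A) sequentially"
    using pos by (intro order_tendstoD(2)) auto
  moreover have "eventually (\<lambda>k. w k < measure M A) sequentially"
    using pos w_tendsto_zero by (intro order_tendstoD(2)) auto
  ultimately have "eventually (\<lambda>k. 1 - real (h k) * w k < measure M A \<and> w k < measure M A) sequentially"
    by (rule eventually_conj)
  then obtain k where k: "1 - real (h k) * w k < measure M A" "w k < measure M A"
    using eventually_happens'[OF sequentially_bot] by blast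
  define S where "S = (\<Union>a<h k. lev k a)"
  have S: "S \<in> sets M" unfolding S_def by (intro sets.finite_UN) (auto intro: lev_sets)
  have "measure M S = (\<Sum>a<h k. measure M (lev k a))"
    unfolding S_def
    by (intro finite_measure_finite_Union) (auto simp: disjoint_family_on_def intro: lev_sets dest: lev_unique)
  then have mS: "measure M S = real (h k) * w k" by (simp add: measure_lev)
  have "\<exists>a<h k. 0 < measure M (A \<inter> lev k a)"
  proof (rule ccontr)
    assume "\<not> ?thesis"
    then have "measure M (A \<inter> lev k a) = 0" if "a < h k" for a
      using that by (metis measure_nonneg order_le_less)
    moreover have "measure M (\<Union>a<h k. A \<inter> lev k a) \<le> (\<Sum>a<h k. measure M (A \<inter> lev k a))"
      using A(1) lev_sets by (intro finite_measure_subadditive_finite) auto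
    ultimately have "measure M (A \<inter> S) \<le> 0" by (simp add: S_def)
    moreover have "measure M A \<le> measure M (A \<inter> S) + measure M (space M - S)"
    proof -
      have "measure M A \<le> measure M ((A \<inter> S) \<union> (space M - S))"
      proof (rule finite_measure_mono)
        show "A \<inter> S \<union> (space M - S) \<in> sets M"
          using A(1) S by (intro sets.Un sets.Int sets.compl_sets)
      qed (use sets.sets_into_space[OF A(1)] in blast)
      also have "\<dots> \<le> measure M (A \<inter> S) + measure M (space M - S)"
        using A(1) S by (intro measure_Un_le sets.Int sets.compl_sets)
      finally show ?thesis .
    qed
    moreover have "measure M (space M - S) = 1 - real (h k) * w k"
      using prob_compl[OF S] mS by simp
    ultimately show False using k by simp
  qed
  then obtain a where a: "a < h k" "0 < measure M (A \<inter> lev k a)" by blast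
  have "measure M (A \<inter> lev k a) \<le> w k"
    using finite_measure_mono[of "A \<inter> lev k a" "lev k a"] lev_sets a measure_lev by simp
  then show "\<exists>B\<in>sets M. B \<subseteq> A \<and> 0 < emeasure M B \<and> emeasure M B < emeasure M A"
    using a k(2) A(1) lev_sets[OF a(1)]
    by (intro bexI[of _ "A \<inter> lev k a"]) (auto simp: emeasure_eq_measure ennreal_less_iff)
qed

section \<open>Ergodicity\<close>

lemma set_integral_lev_Suc:
  fixes f :: "real \<Rightarrow> complex"
  assumes "integrable M f" "AE x in M. f (T x) = f x" "a + 1 < h k"
  shows "set_lebesgue_integral M (lev k (a + 1)) f = set_lebesgue_integral M (lev k a) f"
proof -
  have [measurable]: "T \<in> measurable M M" "f \<in> borel_measurable M" "lev k (a + 1) \<in> sets M" "lev k a \<in> sets M"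
    using T_measurable assms lev_sets by auto
  have "set_lebesgue_integral M (lev k (a + 1)) f =
      (\<integral>x. indicator (lev k (a + 1)) x *\<^sub>R f x \<partial>distr M M T)"
    by (simp add: set_lebesgue_integral_def distr_T)
  also have "\<dots> = (\<integral>x. indicator (lev k (a + 1)) (T x) *\<^sub>R f (T x) \<partial>M)"
    by (intro integral_distr) measurable
  also have "\<dots> = (\<integral>x. indicator (lev k a) x *\<^sub>R f x \<partial>M)"
  proof (rule integral_cong_AE)
    show "AE x in M. indicator (lev k (a + 1)) (T x) *\<^sub>R f (T x) = indicator (lev k a) x *\<^sub>R f x"
    proof (rule AE_mp[OF assms(2)], rule AE_I2, rule impI)
      fix x assume "x \<in> space M" "f (T x) = f x"
      then show "indicator (lev k (a + 1)) (T x) *\<^sub>R f (T x) = indicator (lev k a) x *\<^sub>R f x"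
        using T_lev_iff[OF _ assms(3), of x] by (simp add: indicator_def)
    qed
  qed measurable
  finally show ?thesis by (simp add: set_lebesgue_integral_def)
qed

text \<open>
  An invariant function has the same integral over all levels of a tower, so its integral over a
  level is a fixed multiple of the measure of the level.
\<close>

lemma T_ergodic:
  fixes f :: "real \<Rightarrow> complex"
  assumes f: "integrable M f" "AE x in M. f (T x) = f x"
  shows "\<exists>c. AE x in M. f x = c"
proof -
  interpret prob_space M by (rule prob_space_unit_interval_measure)
  let ?J = "\<lambda>k a. set_lebesgue_integral M (lev k a) f"
  have si: "set_integrable M A f" if "A \<in> sets M" for A
    using integrable_mult_indicator[OF that f(1)] by (simp add: set_integrable_def)
  have J_const: "?J k a = ?J k 0" if "a < h k" for k a
    using that
  proof (induction a)
    case (Suc a)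
    then show ?case using set_integral_lev_Suc[OF f, of a k] by simp
  qed simp
  \<comment> \<open>The bottom level of tower \<open>k\<close> splits into \<open>card (P k)\<close>
    levels of the next tower, all with the same integral; \<open>w\<close> obeys the same
    recursion.\<close>
  have J_Suc: "?J k 0 = of_nat (card (P k)) * ?J (Suc k) 0" for k
  proof -
    have top: "s < h (Suc k)" if "s \<in> P k" for s using P_top[OF that] by simp
    have "?J k 0 = set_lebesgue_integral M (\<Union>s\<in>P k. lev (Suc k) s) f"
      using lev_split[of 0 k] h_pos[of k] by simp
    also have "\<dots> = (\<Sum>s\<in>P k. ?J (Suc k) s)"
    proof (rule set_integral_finite_UN_AE[OF P_fin])
      show "AE x in M. x \<in> lev (Suc k) i \<and> x \<in> lev (Suc k) j \<longrightarrow> i = j"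
        if "i \<in> P k" "j \<in> P k" for i j
        using lev_unique top that by (intro AE_I2) blast
    qed (use top lev_sets si in auto)
    also have "\<dots> = (\<Sum>s\<in>P k. ?J (Suc k) 0)"
      using top J_const by (intro sum.cong) auto
    finally show ?thesis by simp
  qed
  \<comment> \<open>The mean of \<open>f\<close> over the bottom level of the first tower, which
    turns out to be its mean over every level.\<close>
  define \<beta> where "\<beta> = ?J 0 0 / of_real (w 0)"
  have J0: "?J k 0 = \<beta> * of_real (w k)" for k
  proof (induction k)
    case 0
    then show ?case using w_pos[of 0] by (simp add: \<beta>_def)
  next
    case (Suc k)
    have "of_nat (card (P k)) * ?J (Suc k) 0 = of_nat (card (P k)) * (\<beta> * of_real (w (Suc k)))"
      using Suc J_Suc[of k] w_Suc[of k] by (simp add: mult_ac)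
    then show ?case using card_P_pos[of k] by simp
  qed
  define g where "g x = f x - \<beta>" for x
  have g: "integrable M g" unfolding g_def using f(1) by (intro Bochner_Integration.integrable_diff) auto
  have gi: "set_integrable M A g" if "A \<in> sets M" for A
    using integrable_mult_indicator[OF that g] by (simp add: set_integrable_def)
  have g_lev: "set_lebesgue_integral M (lev k a) g = 0" if "a < h k" for k a
  proof -
    have "set_lebesgue_integral M (lev k a) g = ?J k a - set_lebesgue_integral M (lev k a) (\<lambda>_. \<beta>)"
      unfolding g_def using si lev_sets[OF that] integrable_mult_indicator[OF lev_sets[OF that], of "\<lambda>_. \<beta>"]
      by (intro set_integral_diff) (simp_all add: set_integrable_def)
    also have "set_lebesgue_integral M (lev k a) (\<lambda>_. \<beta>) = \<beta> * of_real (w k)"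
      using lev_sets[OF that] measure_lev[OF that]
      by (simp add: set_integral_const scaleR_conv_of_real mult.commute emeasure_eq_measure)
    finally show ?thesis using J_const[OF that] J0 by simp
  qed
  define S where "S k = (\<Union>a<h k. lev k a)" for k
  have S_sets [measurable]: "S k \<in> sets M" for k
    unfolding S_def by (intro sets.finite_UN) (auto intro: lev_sets)
  have S_int: "set_lebesgue_integral M (S k) g = 0" for k
  proof -
    have "set_lebesgue_integral M (S k) g = (\<Sum>a<h k. set_lebesgue_integral M (lev k a) g)"
      unfolding S_def
    proof (rule set_integral_finite_UN_AE)
      show "AE x in M. x \<in> lev k i \<and> x \<in> lev k j \<longrightarrow> i = j" if "i \<in> {..<h k}" "j \<in> {..<h k}" for i j
        using lev_unique that by (intro AE_I2) blast
    qed (use lev_sets gi in auto)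
    then show ?thesis using g_lev by simp
  qed
  \<comment> \<open>This is the case of the whole space, required for complements in the induction
    below. Every point lies in all late towers, so the integrals over \<open>S k\<close> converge to
    the full one.\<close>
  have g_total: "(\<integral>x. g x \<partial>M) = 0"
  proof -
    have "(\<lambda>k. \<integral>x. indicator (S k) x *\<^sub>R g x \<partial>M) \<longlonglongrightarrow> (\<integral>x. g x \<partial>M)"
    proof (rule integral_dominated_convergence[where w = "\<lambda>x. norm (g x)"])
      show "AE x in M. (\<lambda>k. indicator (S k) x *\<^sub>R g x) \<longlonglongrightarrow> g x"
      proof (rule AE_I2)
        fix x assume "x \<in> space M"
        then obtain i where i: "\<And>k. i < k \<Longrightarrow> \<exists>b. 0 < b \<and> b + 1 < h k \<and> x \<in> lev k b"
          using lev_cover_later by (metis space_unit_interval_measure)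
        have "x \<in> S k" if "i < k" for k
          using i[OF that] unfolding S_def by force
        then have "eventually (\<lambda>k. indicator (S k) x *\<^sub>R g x = g x) sequentially"
          by (intro eventually_mono[OF eventually_gt_at_top[of i]]) auto
        then show "(\<lambda>k. indicator (S k) x *\<^sub>R g x) \<longlonglongrightarrow> g x" by (rule tendsto_eventually)
      qed
    qed (use g in \<open>auto simp: indicator_def\<close>)
    then have "(\<lambda>k. 0) \<longlonglongrightarrow> (\<integral>x. g x \<partial>M)"
      using S_int by (simp add: set_lebesgue_integral_def)
    then show ?thesis by (simp add: LIMSEQ_const_iff)
  qed
  have gen_Pow: "insert {} gen \<subseteq> Pow {0..<1}" using gen_subset by auto
  have "set_lebesgue_integral M A g = 0" if "A \<in> sigma_sets {0..<1} (insert {} gen)" for A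
    using that
  proof (induction rule: sigma_sets_induct_disjoint[OF Int_stable_gen gen_Pow, consumes 1, case_names basic empty compl union])
    case (basic A)
    then show ?case using g_lev by (auto simp: gen_def set_lebesgue_integral_def)
  next
    case empty
    then show ?case by (simp add: set_lebesgue_integral_def)
  next
    case (compl A)
    then have A: "A \<in> sets M" by (simp add: sets_M)
    have "set_lebesgue_integral M (A \<union> ({0..<1} - A)) g =
        set_lebesgue_integral M A g + set_lebesgue_integral M ({0..<1} - A) g"
      using A sets.compl_sets[OF A] gi by (intro set_integral_Un) auto
    moreover have "A \<union> ({0..<1} - A) = space M" using sets.sets_into_space[OF A] by auto
    ultimately show ?case using compl g_total set_integral_space[OF g] by simp
  next
    case (union A)
    then have A: "A i \<in> sets M" for i by (auto simp: sets_M)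
    have "set_lebesgue_integral M (\<Union>i. A i) g = (\<Sum>i. set_lebesgue_integral M (A i) g)"
    proof (rule lebesgue_integral_countable_add)
      show "A i \<inter> A j = {}" if "i \<noteq> j" for i j using union(1) that by (auto simp: disjoint_family_on_def)
    qed (use A gi in auto)
    then show ?case using union by simp
  qed
  then have "AE x in M. g x = 0"
    using g by (intro density_zero) (simp_all add: sets_M)
  then show ?thesis unfolding g_def by (intro exI[of _ \<beta>]) simp
qed

end

section \<open>Eigenvalues and factors\<close>

lemma invertible_pmp_systemD:
  assumes "invertible_pmp_system M T"
  shows "prob_space M" "T \<in> measurable M M" "distr M M T = M"
  using assms by (auto simp: invertible_pmp_system_def invertible_mp_def)

lemma funpow_measure_preserving:
  assumes "T \<in> measurable M M" "distr M M T = M"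
  shows "T ^^ n \<in> measurable M M \<and> distr M M (T ^^ n) = M"
proof (induction n)
  case 0
  then show ?case by (simp add: id_def distr_id)
next
  case (Suc n)
  then have "distr M M (T \<circ> T ^^ n) = distr (distr M M (T ^^ n)) M T"
    using assms by (intro distr_distr[symmetric]) auto
  then have "distr M M (T \<circ> T ^^ n) = M" using Suc assms(2) by simp
  moreover have "T \<circ> T ^^ n \<in> measurable M M" using Suc assms(1) by (intro measurable_comp) auto
  ultimately show ?case by (simp only: funpow.simps)
qed

lemma AE_measure_preserving:
  assumes "g \<in> measurable M M" "distr M M g = M" "AE x in M. Q x"
  shows "AE x in M. Q (g x)"
  by (rule AE_distrD[OF assms(1)]) (simp only: assms(2,3))

context
  fixes M :: "'a measure" and T :: "'a \<Rightarrow> 'a" and \<mu> :: complex and f :: "'a \<Rightarrow> complex"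
  assumes sys: "invertible_pmp_system M T" and eig: "koopman_eigenfunction M T \<mu> f"
begin

lemma eigenfunction_measurable: "f \<in> borel_measurable M"
  and eigenfunction_integrable: "integrable M (\<lambda>x. (norm (f x))\<^sup>2)"
  and eigenfunction_nonzero: "\<not> (AE x in M. f x = 0)"
  and eigenfunction_AE: "AE x in M. f (T x) = \<mu> * f x"
  using eig by (auto simp: koopman_eigenfunction_def in_L2_def koopman_def)

lemma eigenfunction_norm_pos: "0 < (\<integral>x. (norm (f x))\<^sup>2 \<partial>M)"
proof -
  have "(\<integral>x. (norm (f x))\<^sup>2 \<partial>M) \<noteq> 0"
    using eigenfunction_nonzero integral_nonneg_eq_0_iff_AE[OF eigenfunction_integrable] by simp
  moreover have "0 \<le> (\<integral>x. (norm (f x))\<^sup>2 \<partial>M)" by simp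
  ultimately show ?thesis by linarith
qed

text \<open>The Koopman operator preserves the norm and the eigenfunction has positive norm.\<close>

lemma eigenvalue_norm: "norm \<mu> = 1"
proof -
  note T = invertible_pmp_systemD[OF sys]
  have [measurable]: "T \<in> measurable M M" "f \<in> borel_measurable M"
    using T eigenfunction_measurable by auto
  have "(\<integral>x. (norm (f x))\<^sup>2 \<partial>M) = (\<integral>x. (norm (f x))\<^sup>2 \<partial>distr M M T)" by (simp add: T)
  also have "\<dots> = (\<integral>x. (norm (f (T x)))\<^sup>2 \<partial>M)" by (intro integral_distr) measurable
  also have "\<dots> = (\<integral>x. (norm \<mu>)\<^sup>2 * (norm (f x))\<^sup>2 \<partial>M)"
    using eigenfunction_AE by (intro integral_cong_AE) (measurable, auto simp: norm_mult power_mult_distrib)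
  finally have "(norm \<mu>)\<^sup>2 = 1" using eigenfunction_norm_pos by simp
  then have "norm \<mu> = 1 \<or> norm \<mu> = - 1" by (simp only: power2_eq_1_iff)
  then show ?thesis using norm_ge_zero[of \<mu>] by linarith
qed

lemma eigenfunction_funpow: "AE x in M. f ((T ^^ n) x) = \<mu> ^ n * f x"
proof (induction n)
  case (Suc n)
  note T = invertible_pmp_systemD[OF sys]
  have "AE x in M. f (T ((T ^^ n) x)) = \<mu> * f ((T ^^ n) x)"
    using funpow_measure_preserving[OF T(2,3), of n]
    by (intro AE_measure_preserving[OF _ _ eigenfunction_AE]) blast+
  with Suc show ?case by eventually_elim simp
qed simp

text \<open>The eigenfunction itself is the test function: its distance to its \<open>k\<close>-th
  translate is \<open>norm (\<mu> ^ k - 1)\<close> times its norm, which is positive.\<close>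

lemma eigenvalue_power_tendsto:
  assumes "rigidity_sequence M T m"
  shows "(\<lambda>n. \<mu> ^ m n) \<longlonglongrightarrow> 1"
proof -
  note T = invertible_pmp_systemD[OF sys]
  have [measurable]: "T ^^ n \<in> measurable M M" "f \<in> borel_measurable M" for n
    using funpow_measure_preserving[OF T(2,3)] eigenfunction_measurable by auto
  have L: "L2_norm M (\<lambda>x. f ((T ^^ k) x) - f x) = norm (\<mu> ^ k - 1) * L2_norm M f" for k
  proof -
    have "(\<integral>x. (norm (f ((T ^^ k) x) - f x))\<^sup>2 \<partial>M) = (\<integral>x. (norm (\<mu> ^ k - 1))\<^sup>2 * (norm (f x))\<^sup>2 \<partial>M)"
    proof (rule integral_cong_AE)
      show "AE x in M. (norm (f ((T ^^ k) x) - f x))\<^sup>2 = (norm (\<mu> ^ k - 1))\<^sup>2 * (norm (f x))\<^sup>2"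
        using eigenfunction_funpow[of k]
      proof eventually_elim
        case (elim x)
        then have "f ((T ^^ k) x) - f x = (\<mu> ^ k - 1) * f x" by (simp add: algebra_simps)
        then show ?case by (simp add: norm_mult power_mult_distrib)
      qed
    qed measurable
    then show ?thesis by (simp add: L2_norm_def real_sqrt_mult)
  qed
  have pos: "0 < L2_norm M f" using eigenfunction_norm_pos by (simp add: L2_norm_def)
  have "(\<lambda>n. L2_norm M (\<lambda>x. f ((T ^^ m n) x) - f x)) \<longlonglongrightarrow> 0"
    using assms eig by (auto simp: rigidity_sequence_def koopman_eigenfunction_def)
  then have "(\<lambda>n. norm (\<mu> ^ m n - 1) * L2_norm M f / L2_norm M f) \<longlonglongrightarrow> 0 / L2_norm M f"
    unfolding L using pos by (intro tendsto_divide) auto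
  then have "(\<lambda>n. norm (\<mu> ^ m n - 1)) \<longlonglongrightarrow> 0" using pos by simp
  then have "(\<lambda>n. \<mu> ^ m n - 1) \<longlonglongrightarrow> 0" by (simp add: tendsto_norm_zero_iff)
  then show ?thesis by (simp add: LIM_zero_iff)
qed

end

text \<open>Real and imaginary part are coded as sets of naturals and interleaved on the even and
  the odd numbers. A bare injection suffices because the measurable structure will be transported
  along it.\<close>

lemma exists_inj_complex_real: "\<exists>j :: complex \<Rightarrow> real. inj j"
proof -
  obtain b :: "real \<Rightarrow> nat set" where b: "inj b"
    using eqpoll_sym[OF nat_sets_eqpoll_reals] by (auto simp: eqpoll_def bij_betw_def)
  obtain c :: "nat set \<Rightarrow> real" where c: "inj c"
    using nat_sets_eqpoll_reals by (auto simp: eqpoll_def bij_betw_def)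
  define e where "e z = (\<lambda>n. 2 * n) ` b (Re z) \<union> (\<lambda>n. 2 * n + 1) ` b (Im z)" for z
  have "b (Re z) = {n. 2 * n \<in> e z}" "b (Im z) = {n. 2 * n + 1 \<in> e z}" for z
    unfolding e_def by (auto, presburger+)
  then have "Re x = Re y \<and> Im x = Im y" if "e x = e y" for x y
    using that b by (metis injD)
  then have "inj e" by (intro injI complex_eqI) blast+
  then show ?thesis using inj_compose[OF c] by blast
qed


text \<open>
  An eigenfunction is a factor map onto the multiplication by its eigenvalue on \<open>complex\<close>; any
  injection of \<open>complex\<close> into \<open>real\<close> carries this factor to the type \<open>real\<close>.
\<close>

lemma eigenvalue_factor_on_real:
  fixes M :: "'a measure"
  assumes sys: "invertible_pmp_system M T" and "koopman_eigenvalue M T \<mu>"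
  shows "\<exists>(N :: real measure) S. invertible_pmp_system N S \<and> koopman_eigenvalue N S \<mu> \<and>
    (\<forall>m. rigidity_sequence M T m \<longrightarrow> rigidity_sequence N S m)"
proof -
  obtain f where eig: "koopman_eigenfunction M T \<mu> f"
    using assms(2) by (auto simp: koopman_eigenvalue_def)
  obtain j :: "complex \<Rightarrow> real" where j: "inj j" using exists_inj_complex_real by blast
  note T = invertible_pmp_systemD[OF sys]
  note f = eigenfunction_measurable[OF sys eig] eigenfunction_integrable[OF sys eig]
    eigenfunction_nonzero[OF sys eig] eigenfunction_AE[OF sys eig]
  have \<mu>: "\<mu> \<noteq> 0" using eigenvalue_norm[OF sys eig] by auto
  \<comment> \<open>\<open>D\<close> is the law of the eigenfunction. \<open>N\<close> carries the
    sigma-algebra transported by \<open>j\<close> in place of the Borel sets of the line, which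
    makes \<open>j\<close> measurable by construction.\<close>
  define D where "D = distr M borel f"
  define N where "N = embed_measure D j"
  define \<phi> where "\<phi> = inv j"
  have \<phi>_j: "\<phi> (j z) = z" for z using j by (simp add: \<phi>_def)
  define S where "S y = j (\<mu> * \<phi> y)" for y
  define g where "g x = j (f x)" for x
  have S_j: "S (j z) = j (\<mu> * z)" for z by (simp add: S_def \<phi>_j)
  have sets_D: "sets D = sets borel" by (simp add: D_def)
  have space_N: "space N = range j" by (simp add: N_def D_def space_embed_measure)
  have f_meas [measurable]: "f \<in> measurable M D" using f(1) by (simp add: D_def)
  have j_meas [measurable]: "j \<in> measurable D N"
    unfolding N_def by (rule measurable_embed_measure2[OF j])
  have T_meas [measurable]: "T \<in> measurable M M" by (rule T)
  have g_meas [measurable]: "g \<in> measurable M N" unfolding g_def by measurable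
  have mult_meas: "(\<lambda>z. c * z) \<in> measurable D D" for c
    by (simp add: D_def)
  have mult_meas_N: "(\<lambda>y. j (c * \<phi> y)) \<in> measurable N N" for c
  proof -
    have "(\<lambda>z. j (c * \<phi> (j z))) \<in> measurable D N"
      unfolding \<phi>_j using measurable_compose[OF mult_meas j_meas] .
    then show ?thesis unfolding N_def by (rule measurable_embed_measure1)
  qed
  have S_meas [measurable]: "S \<in> measurable N N"
    unfolding S_def by (rule mult_meas_N)
  have \<phi>_meas [measurable]: "\<phi> \<in> borel_measurable N"
    unfolding N_def by (rule measurable_embed_measure1) (simp add: \<phi>_j D_def)
  have N_distr: "distr M N g = N"
  proof -
    have "N = distr D N j" unfolding N_def by (rule embed_measure_eq_distr[OF j])
    also have "\<dots> = distr M N (j \<circ> f)"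
    proof -
      have "D = distr M D f" unfolding D_def by (rule distr_cong) auto
      then have "distr D N j = distr (distr M D f) N j" by simp
      also have "\<dots> = distr M N (j \<circ> f)" by (rule distr_distr) measurable
      finally show ?thesis .
    qed
    also have "j \<circ> f = g" by (auto simp: g_def)
    finally show ?thesis by simp
  qed
  have equivariant: "AE x in M. S (g x) = g (T x)"
    using f(4) by (rule AE_mp) (simp add: S_j g_def)
  have equivariant_funpow: "AE x in M. (S ^^ k) (g x) = g ((T ^^ k) x)" for k
  proof (induction k)
    case (Suc k)
    have "AE x in M. S (g ((T ^^ k) x)) = g (T ((T ^^ k) x))"
      using funpow_measure_preserving[OF T(2,3), of k]
      by (intro AE_measure_preserving[OF _ _ equivariant]) blast+
    with Suc show ?case by eventually_elim simp
  qed simp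
  have S_inj: "inj_on S (range j)"
    by (auto intro!: inj_onI simp: S_j inj_eq[OF j] \<mu>)
  \<comment> \<open>Taking all of \<open>complex\<close> as the factor space, and not just the image
    of \<open>f\<close>, makes the inverse explicit at every point: multiplication by
    \<open>inverse \<mu>\<close>.\<close>
  have S_inv: "S (j (inverse \<mu> * \<phi> y)) = y" if "y \<in> range j" for y
    using that \<mu> by (auto simp: S_j \<phi>_j mult.assoc[symmetric])
  have S_bij: "bij_betw S (range j) (range j)"
    unfolding bij_betw_def
  proof (intro conjI S_inj equalityI subsetI)
    fix y assume "y \<in> range j"
    then show "y \<in> S ` range j" using S_inv[of y] by (metis image_eqI rangeI)
  qed (auto simp: S_j)
  have "the_inv_into (space N) S \<in> measurable N N"
  proof (rule measurable_cong[THEN iffD2, OF _ mult_meas_N])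
    fix y assume "y \<in> space N"
    then have "y \<in> range j" by (simp add: space_N)
    then show "the_inv_into (space N) S y = j (inverse \<mu> * \<phi> y)"
      unfolding space_N using S_inv by (intro the_inv_into_f_eq[OF S_inj]) auto
  qed
  moreover have "distr N N S = N"
  proof -
    have "distr N N S = distr (distr M N g) N S" by (simp only: N_distr)
    also have "\<dots> = distr M N (S \<circ> g)" by (rule distr_distr) measurable
    also have "\<dots> = distr M N (g \<circ> T)"
      using equivariant by (intro distr_cong_AE) (auto simp: comp_def)
    also have "\<dots> = distr (distr M M T) N g" by (rule distr_distr[symmetric]) measurable
    also have "\<dots> = N" by (simp only: T(3) N_distr)
    finally show ?thesis .
  qed
  moreover have "prob_space N"
    using prob_space.prob_space_distr[OF T(1) g_meas] by (simp only: N_distr)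
  ultimately have "invertible_pmp_system N S"
    using S_bij S_meas by (simp add: invertible_pmp_system_def invertible_mp_def space_N)
  moreover have "koopman_eigenfunction N S \<mu> \<phi>"
    unfolding koopman_eigenfunction_def in_L2_def koopman_def
  proof (intro conjI)
    have "integrable (distr M N g) (\<lambda>y. (norm (\<phi> y))\<^sup>2) \<longleftrightarrow> integrable M (\<lambda>x. (norm (\<phi> (g x)))\<^sup>2)"
      by (intro integrable_distr_eq) measurable
    then show "integrable N (\<lambda>y. (norm (\<phi> y))\<^sup>2)"
      using f(2) by (simp add: N_distr g_def \<phi>_j)
    have "(AE y in distr M N g. \<phi> y = 0) \<longleftrightarrow> (AE x in M. \<phi> (g x) = 0)"
      by (intro AE_distr_iff) measurable
    then show "\<not> (AE y in N. \<phi> y = 0)" using f(3) unfolding N_distr by (simp only: g_def \<phi>_j) simp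
    show "AE y in N. (\<phi> \<circ> S) y = \<mu> * \<phi> y" by (simp add: S_def \<phi>_j)
  qed measurable
  moreover have "rigidity_sequence N S m" if "rigidity_sequence M T m" for m
    unfolding rigidity_sequence_def
  proof (intro allI impI)
    fix F assume "in_L2 N F"
    then have F [measurable]: "F \<in> borel_measurable N" and F2: "integrable N (\<lambda>y. (norm (F y))\<^sup>2)"
      by (auto simp: in_L2_def)
    have "integrable (distr M N g) (\<lambda>y. (norm (F y))\<^sup>2) \<longleftrightarrow> integrable M (\<lambda>x. (norm (F (g x)))\<^sup>2)"
      by (intro integrable_distr_eq) measurable
    then have "in_L2 M (\<lambda>x. F (g x))"
      using F2 by (simp add: N_distr in_L2_def)
    then have lim: "(\<lambda>n. L2_norm M (\<lambda>x. F (g ((T ^^ m n) x)) - F (g x))) \<longlonglongrightarrow> 0"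
      using that by (auto simp: rigidity_sequence_def)
    \<comment> \<open>Lifting along \<open>g\<close> is isometric, and the lift intertwines the
      iterates, although only almost everywhere because the eigenvalue equation holds only
      so.\<close>
    have "L2_norm N (\<lambda>y. F ((S ^^ k) y) - F y) = L2_norm M (\<lambda>x. F (g ((T ^^ k) x)) - F (g x))" for k
    proof -
      have [measurable]: "T ^^ k \<in> measurable M M"
        using funpow_measure_preserving[OF T(2,3)] by blast
      have [measurable]: "S ^^ k \<in> measurable N N" by (rule measurable_compose_n[OF S_meas])
      have "(\<integral>y. (norm (F ((S ^^ k) y) - F y))\<^sup>2 \<partial>distr M N g) =
          (\<integral>x. (norm (F ((S ^^ k) (g x)) - F (g x)))\<^sup>2 \<partial>M)"
        by (intro integral_distr) measurable
      also have "\<dots> = (\<integral>x. (norm (F (g ((T ^^ k) x)) - F (g x)))\<^sup>2 \<partial>M)"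
      proof (rule integral_cong_AE)
        show "AE x in M. (norm (F ((S ^^ k) (g x)) - F (g x)))\<^sup>2 = (norm (F (g ((T ^^ k) x)) - F (g x)))\<^sup>2"
          using equivariant_funpow[of k] by eventually_elim simp
      qed measurable
      finally show ?thesis by (simp add: L2_norm_def N_distr)
    qed
    then show "(\<lambda>n. L2_norm N (\<lambda>y. F ((S ^^ m n) y) - F y)) \<longlonglongrightarrow> 0" using lim by simp
  qed
  ultimately show ?thesis by (auto simp: koopman_eigenvalue_def)
qed

section \<open>Rigidity\<close>

text \<open>The sets with vanishing escape form a sigma-algebra, so it is enough to test
  generators.\<close>

lemma in_sets_return_tendsto:
  fixes U :: "nat \<Rightarrow> 'a \<Rightarrow> 'a"
  assumes "prob_space M" and U: "\<And>n. U n \<in> measurable M M" "\<And>n. distr M M (U n) = M"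
    and sets_M: "sets M = sigma_sets (space M) E"
    and E: "\<And>A. A \<in> E \<Longrightarrow> (\<lambda>n. measure M (A - U n -` A)) \<longlonglongrightarrow> 0"
    and "A \<in> sets M"
  shows "(\<lambda>n. measure M (A - U n -` A)) \<longlonglongrightarrow> 0"
proof -
  interpret prob_space M by fact
  have vim: "U n -` A \<inter> space M \<in> sets M" if "A \<in> sets M" for A n
    using measurable_sets[OF U(1) that] .
  have diff: "A - U n -` A \<in> sets M" if "A \<in> sets M" for A n
  proof -
    have "A - U n -` A = A - U n -` A \<inter> space M" using sets.sets_into_space[OF that] by auto
    then show ?thesis using sets.Diff[OF that vim[OF that, of n]] by simp
  qed
  have mU: "measure M (U n -` A \<inter> space M) = measure M A" if "A \<in> sets M" for A n
    using measure_distr[OF U(1) that, of n] U(2)[of n] by simp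
  have "A \<in> sigma_sets (space M) E" using assms(6) sets_M by simp
  then show ?thesis
  proof (induction rule: sigma_sets.induct)
    case (Compl A)
    then have A: "A \<in> sets M" using sets_M by simp
    \<comment> \<open>\<open>A\<close> and its preimage have equal measure, hence so do the two
      halves of their symmetric difference.\<close>
    have "measure M (space M - A - U n -` (space M - A)) = measure M (A - U n -` A)" for n
    proof -
      have "space M - A - U n -` (space M - A) = (U n -` A \<inter> space M) - A"
        using measurable_space[OF U(1)] by auto
      also have "\<dots> = (U n -` A \<inter> space M) - (A \<inter> (U n -` A \<inter> space M))" by auto
      also have "measure M \<dots> = measure M A - measure M (A \<inter> (U n -` A \<inter> space M))"
        using vim[OF A, of n] A mU[OF A, of n] by (subst finite_measure_Diff) auto
      also have "\<dots> = measure M (A - (A \<inter> (U n -` A \<inter> space M)))"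
        using vim[OF A, of n] A by (subst finite_measure_Diff) auto
      also have "A - (A \<inter> (U n -` A \<inter> space M)) = A - U n -` A"
        using sets.sets_into_space[OF A] by auto
      finally show ?thesis .
    qed
    then show ?case using Compl by simp
  next
    case (Union A)
    then have A: "A i \<in> sets M" for i using sets_M by simp
    let ?B = "\<lambda>K. \<Union>i<K. A i" and ?A = "\<Union>i. A i"
    have B_sets: "?B K \<in> sets M" "?A \<in> sets M" for K using A by auto
    have "(\<Union>K. ?B K) = ?A" by auto
    moreover have "(\<lambda>K. measure M (?B K)) \<longlonglongrightarrow> measure M (\<Union>K. ?B K)"
    proof (rule finite_Lim_measure_incseq)
      show "incseq ?B" by (intro monoI UN_mono) auto
    qed (use B_sets in auto)
    ultimately have B_lim: "(\<lambda>K. measure M (?B K)) \<longlonglongrightarrow> measure M ?A" by simp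
    show ?case
    proof (rule LIMSEQ_I)
      fix e :: real assume e: "0 < e"
      have "eventually (\<lambda>K. measure M ?A - e / 2 < measure M (?B K)) sequentially"
        using B_lim e by (intro order_tendstoD(1)) auto
      then obtain K where K: "measure M ?A - e / 2 < measure M (?B K)"
        using eventually_happens'[OF sequentially_bot] by blast
      have "(\<lambda>n. \<Sum>i<K. measure M (A i - U n -` A i)) \<longlonglongrightarrow> (\<Sum>i<K. 0)"
        using Union by (intro tendsto_sum) auto
      then have "eventually (\<lambda>n. (\<Sum>i<K. measure M (A i - U n -` A i)) < e / 2) sequentially"
        using e by (intro order_tendstoD(2)) auto
      then obtain n0 where n0: "\<And>n. n0 \<le> n \<Longrightarrow> (\<Sum>i<K. measure M (A i - U n -` A i)) < e / 2"
        by (auto simp: eventually_sequentially)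
      have "measure M (?A - U n -` ?A) < e" if "n0 \<le> n" for n
      proof -
        \<comment> \<open>A point leaving the union leaves one of the first \<open>K\<close> sets or
          lies in the tail; the tail is small uniformly in \<open>n\<close>.\<close>
        have "measure M (?A - U n -` ?A) \<le> measure M ((\<Union>i<K. A i - U n -` A i) \<union> (?A - ?B K))"
          using A diff by (intro finite_measure_mono) auto
        also have "\<dots> \<le> measure M (\<Union>i<K. A i - U n -` A i) + measure M (?A - ?B K)"
          using A diff by (intro measure_Un_le) auto
        also have "\<dots> \<le> (\<Sum>i<K. measure M (A i - U n -` A i)) + (measure M ?A - measure M (?B K))"
        proof (rule add_mono)
          show "measure M (\<Union>i<K. A i - U n -` A i) \<le> (\<Sum>i<K. measure M (A i - U n -` A i))"
            using diff A by (intro finite_measure_subadditive_finite) auto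
          show "measure M (?A - ?B K) \<le> measure M ?A - measure M (?B K)"
            using B_sets by (subst finite_measure_Diff) auto
        qed
        finally show ?thesis using n0[OF that] K by linarith
      qed
      then show "\<exists>n0. \<forall>n\<ge>n0. norm (measure M (?A - U n -` ?A) - 0) < e" by auto
    qed
  qed (use E in auto)
qed

text \<open>Where \<open>s\<close> changes along the orbit, the point leaves its own level set of
  \<open>s\<close>. The integrand is thus at most \<open>(2 * B)\<^sup>2\<close> times a finite sum
  of indicators of escaping sets.\<close>

lemma simple_function_return_tendsto:
  fixes U :: "nat \<Rightarrow> 'a \<Rightarrow> 'a" and s :: "'a \<Rightarrow> complex"
  assumes "prob_space M" and U: "\<And>n. U n \<in> measurable M M"
    and ret: "\<And>A. A \<in> sets M \<Longrightarrow> (\<lambda>n. measure M (A - U n -` A)) \<longlonglongrightarrow> 0"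
    and s: "simple_function M s"
  shows "(\<lambda>n. \<integral>x. (norm (s (U n x) - s x))\<^sup>2 \<partial>M) \<longlonglongrightarrow> 0"
proof -
  interpret prob_space M by fact
  define V where "V = s ` space M"
  have V: "finite V" using s by (simp add: V_def simple_function_def)
  have s_meas [measurable]: "s \<in> borel_measurable M" using s by (rule borel_measurable_simple_function)
  obtain B where B: "\<And>v. v \<in> V \<Longrightarrow> norm v \<le> B"
    using finite_imp_bounded[OF V] by (auto simp: bounded_iff)
  define A where "A v = s -` {v} \<inter> space M" for v
  have A: "A v \<in> sets M" for v unfolding A_def by measurable
  have diff: "A v - U n -` A v \<in> sets M" for v n
  proof -
    have "A v - U n -` A v = A v - (U n -` A v \<inter> space M)" by (auto simp: A_def)
    then show ?thesis using sets.Diff[OF A measurable_sets[OF U A]] by simp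
  qed
  have bound: "(norm (s (U n x) - s x))\<^sup>2 \<le> (2 * B)\<^sup>2 * (\<Sum>v\<in>V. indicator (A v - U n -` A v) x)"
    if "x \<in> space M" for n x
  proof (cases "s (U n x) = s x")
    case True
    have "0 \<le> (2 * B)\<^sup>2 * (\<Sum>v\<in>V. indicator (A v - U n -` A v) x :: real)"
      by (intro mult_nonneg_nonneg sum_nonneg) auto
    then show ?thesis using True by simp
  next
    case False
    have Ux: "U n x \<in> space M" using measurable_space[OF U that] .
    have "norm (s (U n x) - s x) \<le> norm (s (U n x)) + norm (s x)" by (rule norm_triangle_ineq4)
    also have "\<dots> \<le> 2 * B" using B[of "s (U n x)"] B[of "s x"] that Ux by (auto simp: V_def)
    finally have 1: "(norm (s (U n x) - s x))\<^sup>2 \<le> (2 * B)\<^sup>2" by (intro power_mono) auto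
    have "x \<in> A (s x) - U n -` A (s x)" using False that by (auto simp: A_def)
    then have "(1::real) = indicator (A (s x) - U n -` A (s x)) x" by simp
    also have "\<dots> \<le> (\<Sum>v\<in>V. indicator (A v - U n -` A v) x)"
      using V that by (intro member_le_sum) (auto simp: V_def)
    finally have "(2 * B)\<^sup>2 * 1 \<le> (2 * B)\<^sup>2 * (\<Sum>v\<in>V. indicator (A v - U n -` A v) x)"
      by (intro mult_left_mono) auto
    then show ?thesis using 1 by simp
  qed
  have le: "(\<integral>x. (norm (s (U n x) - s x))\<^sup>2 \<partial>M) \<le> (2 * B)\<^sup>2 * (\<Sum>v\<in>V. measure M (A v - U n -` A v))" for n
  proof -
    have ind: "integrable M (\<lambda>x. indicator (A v - U n -` A v) x :: real)" for v
      using diff by (simp add: integrable_indicator_iff emeasure_eq_measure)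
    have int: "integrable M (\<lambda>x. (2 * B)\<^sup>2 * (\<Sum>v\<in>V. indicator (A v - U n -` A v) x :: real))"
      using ind by (intro integrable_mult_right integrable_sum) auto
    have "(\<integral>x. (norm (s (U n x) - s x))\<^sup>2 \<partial>M) \<le>
        (\<integral>x. (2 * B)\<^sup>2 * (\<Sum>v\<in>V. indicator (A v - U n -` A v) x) \<partial>M)"
    proof (rule integral_mono_AE'[OF int])
      show "AE x in M. 0 \<le> (2 * B)\<^sup>2 * (\<Sum>v\<in>V. indicator (A v - U n -` A v) x :: real)"
        by (intro AE_I2 mult_nonneg_nonneg sum_nonneg) auto
    qed (rule AE_I2, rule bound)
    also have "\<dots> = (2 * B)\<^sup>2 * (\<Sum>v\<in>V. \<integral>x. indicator (A v - U n -` A v) x \<partial>M)"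
      using ind by (simp add: Bochner_Integration.integral_sum)
    also have "(\<lambda>v. \<integral>x. (indicator (A v - U n -` A v) x :: real) \<partial>M) = (\<lambda>v. measure M (A v - U n -` A v))"
      using diff sets.sets_into_space by (intro ext) (simp add: Int_absorb2)
    finally show ?thesis .
  qed
  have "(\<lambda>n. (2 * B)\<^sup>2 * (\<Sum>v\<in>V. measure M (A v - U n -` A v))) \<longlonglongrightarrow> (2 * B)\<^sup>2 * (\<Sum>v\<in>V. 0)"
    using ret A by (intro tendsto_intros) auto
  then have lim: "(\<lambda>n. (2 * B)\<^sup>2 * (\<Sum>v\<in>V. measure M (A v - U n -` A v))) \<longlonglongrightarrow> 0" by simp
  show ?thesis
  proof (rule tendsto_sandwich[OF _ _ tendsto_const lim])
    show "eventually (\<lambda>n. (\<integral>x. (norm (s (U n x) - s x))\<^sup>2 \<partial>M) \<le>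
        (2 * B)\<^sup>2 * (\<Sum>v\<in>V. measure M (A v - U n -` A v))) sequentially"
      by (intro always_eventually allI le)
  qed auto
qed

text \<open>Serves in place of the triangle inequality of the square-integrable functions; the
  constant 3 is why the errors below are taken as \<open>e / 9\<close>.\<close>

lemma norm_add3_squared_le:
  fixes a b c :: complex
  shows "(norm (a + b + c))\<^sup>2 \<le> 3 * ((norm a)\<^sup>2 + (norm b)\<^sup>2 + (norm c)\<^sup>2)"
proof -
  have "norm (a + b + c) \<le> norm a + norm b + norm c"
    by (meson norm_triangle_ineq norm_triangle_mono order_refl)
  then have "(norm (a + b + c))\<^sup>2 \<le> (norm a + norm b + norm c)\<^sup>2" by (intro power_mono) auto
  moreover have "3 * ((norm a)\<^sup>2 + (norm b)\<^sup>2 + (norm c)\<^sup>2) - (norm a + norm b + norm c)\<^sup>2 =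
      (norm a - norm b)\<^sup>2 + (norm a - norm c)\<^sup>2 + (norm b - norm c)\<^sup>2"
    by (simp add: power2_eq_square algebra_simps)
  moreover have "0 \<le> (norm a - norm b)\<^sup>2 + (norm a - norm c)\<^sup>2 + (norm b - norm c)\<^sup>2" by simp
  ultimately show ?thesis by linarith
qed

text \<open>Dominated convergence: the approximants satisfy
  \<open>norm (s i x) \<le> 2 * norm (f x)\<close>, so the squared error is at most
  \<open>9 * (norm (f x))\<^sup>2\<close>.\<close>

lemma L2_approximation_simple:
  assumes "in_L2 M f" "0 < e"
  shows "\<exists>s. simple_function M s \<and> integrable M (\<lambda>x. (norm (s x - f x))\<^sup>2) \<and>
    (\<integral>x. (norm (s x - f x))\<^sup>2 \<partial>M) < e"
proof -
  have f [measurable]: "f \<in> borel_measurable M" and f2: "integrable M (\<lambda>x. (norm (f x))\<^sup>2)"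
    using assms by (auto simp: in_L2_def)
  obtain s where "\<forall>i. simple_function M (s i)" "\<forall>x\<in>space M. (\<lambda>i. s i x) \<longlonglongrightarrow> f x"
    "\<forall>i. \<forall>x\<in>space M. dist (s i x) 0 \<le> 2 * dist (f x) 0"
    using borel_measurable_implies_sequence_metric[OF f, of 0] by blast
  then have s: "simple_function M (s i)" "x \<in> space M \<Longrightarrow> (\<lambda>i. s i x) \<longlonglongrightarrow> f x"
    "x \<in> space M \<Longrightarrow> norm (s i x) \<le> 2 * norm (f x)" for i x
    by auto
  have s_meas [measurable]: "s i \<in> borel_measurable M" for i
    using s(1) by (rule borel_measurable_simple_function)
  have bound: "(norm (s i x - f x))\<^sup>2 \<le> 9 * (norm (f x))\<^sup>2" if "x \<in> space M" for i x
  proof -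
    have "norm (s i x - f x) \<le> 3 * norm (f x)"
      using norm_triangle_ineq4[of "s i x" "f x"] s(3)[OF that, of i] by linarith
    then have "(norm (s i x - f x))\<^sup>2 \<le> (3 * norm (f x))\<^sup>2" by (intro power_mono) auto
    then show ?thesis by (simp add: power_mult_distrib)
  qed
  have "(\<lambda>i. \<integral>x. (norm (s i x - f x))\<^sup>2 \<partial>M) \<longlonglongrightarrow> (\<integral>x. 0 \<partial>M)"
  proof (rule integral_dominated_convergence[where w = "\<lambda>x. 9 * (norm (f x))\<^sup>2"])
    show "AE x in M. (\<lambda>i. (norm (s i x - f x))\<^sup>2) \<longlonglongrightarrow> 0"
    proof (rule AE_I2)
      fix x assume "x \<in> space M"
      then have "(\<lambda>i. (norm (s i x - f x))\<^sup>2) \<longlonglongrightarrow> (norm (f x - f x))\<^sup>2"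
        using s(2) by (intro tendsto_intros) auto
      then show "(\<lambda>i. (norm (s i x - f x))\<^sup>2) \<longlonglongrightarrow> 0" by simp
    qed
  qed (use f2 bound in auto)
  then have "eventually (\<lambda>i. (\<integral>x. (norm (s i x - f x))\<^sup>2 \<partial>M) < e) sequentially"
    using assms(2) by (intro order_tendstoD(2)) auto
  then obtain i where "(\<integral>x. (norm (s i x - f x))\<^sup>2 \<partial>M) < e"
    using eventually_happens'[OF sequentially_bot] by blast
  moreover have "integrable M (\<lambda>x. (norm (s i x - f x))\<^sup>2)"
    by (rule Bochner_Integration.integrable_bound[of M "\<lambda>x. 9 * (norm (f x))\<^sup>2"]) (use f2 bound in auto)
  ultimately show ?thesis using s(1) by blast
qed

text \<open>With a simple \<open>s\<close> close to \<open>f\<close>, the difference of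
  \<open>f\<close> and its translate splits into the translate of \<open>f - s\<close>, the same
  difference for \<open>s\<close>, and \<open>s - f\<close>. The outer parts have the same norm by
  invariance, and the middle one tends to 0.\<close>

lemma rigidity_sequenceI_generator:
  assumes sys: "invertible_pmp_system M T" and "sets M = sigma_sets (space M) E"
    and E: "\<And>A. A \<in> E \<Longrightarrow> (\<lambda>n. measure M (A - (T ^^ m n) -` A)) \<longlonglongrightarrow> 0"
  shows "rigidity_sequence M T m"
  unfolding rigidity_sequence_def
proof (intro allI impI)
  note T = invertible_pmp_systemD[OF sys]
  define U where "U n = T ^^ m n" for n
  have U: "U n \<in> measurable M M" "distr M M (U n) = M" for n
    using funpow_measure_preserving[OF T(2,3)] by (auto simp: U_def)
  note [measurable] = U(1)
  have ret: "(\<lambda>n. measure M (A - U n -` A)) \<longlonglongrightarrow> 0" if "A \<in> sets M" for A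
    using in_sets_return_tendsto[OF T(1) U assms(2) _ that] E by (simp add: U_def)
  fix f assume f: "in_L2 M f"
  then have [measurable]: "f \<in> borel_measurable M" by (simp add: in_L2_def)
  have "(\<lambda>n. \<integral>x. (norm (f (U n x) - f x))\<^sup>2 \<partial>M) \<longlonglongrightarrow> 0"
  proof (rule LIMSEQ_I)
    fix e :: real assume e: "0 < e"
    then obtain s where s: "simple_function M s" "integrable M (\<lambda>x. (norm (s x - f x))\<^sup>2)"
      "(\<integral>x. (norm (s x - f x))\<^sup>2 \<partial>M) < e / 9"
      using L2_approximation_simple[OF f, of "e / 9"] by auto
    have [measurable]: "s \<in> borel_measurable M" using s(1) by (rule borel_measurable_simple_function)
    have "eventually (\<lambda>n. (\<integral>x. (norm (s (U n x) - s x))\<^sup>2 \<partial>M) < e / 9) sequentially"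
      using simple_function_return_tendsto[OF T(1) U(1) ret s(1)] e by (intro order_tendstoD(2)) auto
    then obtain n0 where n0: "\<And>n. n0 \<le> n \<Longrightarrow> (\<integral>x. (norm (s (U n x) - s x))\<^sup>2 \<partial>M) < e / 9"
      by (auto simp: eventually_sequentially)
    have "(\<integral>x. (norm (f (U n x) - f x))\<^sup>2 \<partial>M) < e" if "n0 \<le> n" for n
    proof -
      have iU: "integrable M (\<lambda>x. (norm (s (U n x) - f (U n x)))\<^sup>2)"
        using integrable_distr[OF U(1)[of n], of "\<lambda>x. (norm (s x - f x))\<^sup>2"] s(2) by (simp add: U(2))
      have eqU: "(\<integral>x. (norm (s (U n x) - f (U n x)))\<^sup>2 \<partial>M) = (\<integral>x. (norm (s x - f x))\<^sup>2 \<partial>M)"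
      proof -
        have "(\<integral>x. (norm (s x - f x))\<^sup>2 \<partial>distr M M (U n)) = (\<integral>x. (norm (s (U n x) - f (U n x)))\<^sup>2 \<partial>M)"
          by (intro integral_distr) measurable
        then show ?thesis by (simp only: U(2))
      qed
      have iS: "integrable M (\<lambda>x. (norm (s (U n x) - s x))\<^sup>2)"
      proof -
        interpret prob_space M by (rule T(1))
        have "finite (s ` space M)" using s(1) by (simp add: simple_function_def)
        then obtain B where B: "\<And>x. x \<in> space M \<Longrightarrow> norm (s x) \<le> B"
          using finite_imp_bounded[of "s ` space M"] by (auto simp: bounded_iff)
        show ?thesis
        proof (rule integrable_const_bound[where B = "(2 * B)\<^sup>2"])
          show "AE x in M. norm ((norm (s (U n x) - s x))\<^sup>2) \<le> (2 * B)\<^sup>2"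
          proof (rule AE_I2)
            fix x assume x: "x \<in> space M"
            have "norm (s (U n x) - s x) \<le> 2 * B"
              using norm_triangle_ineq4[of "s (U n x)" "s x"] B[OF x] B[OF measurable_space[OF U(1) x], of n]
              by linarith
            then have "(norm (s (U n x) - s x))\<^sup>2 \<le> (2 * B)\<^sup>2" by (intro power_mono) auto
            then show "norm ((norm (s (U n x) - s x))\<^sup>2) \<le> (2 * B)\<^sup>2" by simp
          qed
        qed measurable
      qed
      have "(\<integral>x. (norm (f (U n x) - f x))\<^sup>2 \<partial>M) \<le>
          (\<integral>x. 3 * ((norm (s (U n x) - f (U n x)))\<^sup>2 + (norm (s (U n x) - s x))\<^sup>2 + (norm (s x - f x))\<^sup>2) \<partial>M)"
      proof (rule integral_mono_AE')
        show "AE x in M. (norm (f (U n x) - f x))\<^sup>2 \<le>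
            3 * ((norm (s (U n x) - f (U n x)))\<^sup>2 + (norm (s (U n x) - s x))\<^sup>2 + (norm (s x - f x))\<^sup>2)"
        proof (rule AE_I2)
          fix x
          show "(norm (f (U n x) - f x))\<^sup>2 \<le>
              3 * ((norm (s (U n x) - f (U n x)))\<^sup>2 + (norm (s (U n x) - s x))\<^sup>2 + (norm (s x - f x))\<^sup>2)"
            using norm_add3_squared_le[of "f (U n x) - s (U n x)" "s (U n x) - s x" "s x - f x"]
            by (simp add: norm_minus_commute)
        qed
      qed (use iU iS s(2) in auto)
      also have "\<dots> = 3 * ((\<integral>x. (norm (s (U n x) - f (U n x)))\<^sup>2 \<partial>M) +
          (\<integral>x. (norm (s (U n x) - s x))\<^sup>2 \<partial>M) + (\<integral>x. (norm (s x - f x))\<^sup>2 \<partial>M))"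
        using iU iS s(2) by simp
      finally have le: "(\<integral>x. (norm (f (U n x) - f x))\<^sup>2 \<partial>M) \<le> \<dots>" .
      have "a < e" if "a \<le> 3 * (b + c + d)" "b = d" "d < e / 9" "c < e / 9" for a b c d :: real
        using that by simp
      from this[OF le eqU s(3) n0[OF that]] show ?thesis .
    qed
    then show "\<exists>n0. \<forall>n\<ge>n0. norm ((\<integral>x. (norm (f (U n x) - f x))\<^sup>2 \<partial>M) - 0) < e" by auto
  qed
  then have "(\<lambda>n. sqrt (\<integral>x. (norm (f (U n x) - f x))\<^sup>2 \<partial>M)) \<longlonglongrightarrow> sqrt 0"
    by (rule tendsto_real_sqrt)
  then show "(\<lambda>n. L2_norm M (\<lambda>x. f ((T ^^ m n) x) - f x)) \<longlonglongrightarrow> 0"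
    by (simp add: L2_norm_def U_def)
qed

section \<open>Return estimates for the levels\<close>

context cut_stack
begin

text \<open>If \<open>s\<close> and \<open>s + m\<close> both start copies, then \<open>m\<close>
  steps inside tower \<open>k + 1\<close> carry level \<open>a\<close> of the first copy to level
  \<open>a\<close> of the second. Only copies with \<open>s + m \<notin> P k\<close>
  contribute.\<close>

lemma measure_lev_no_return_le:
  assumes "a < h k"
  shows "measure M (lev k a - (T ^^ m) -` lev k a) \<le> real (card {s \<in> P k. s + m \<notin> P k}) * w (Suc k)"
proof -
  interpret prob_space M by (rule prob_space_unit_interval_measure)
  let ?B = "{s \<in> P k. s + m \<notin> P k}"
  have top: "s + a < h (Suc k)" if "s \<in> P k" for s using P_top[OF that] assms by simp
  have "lev k a - (T ^^ m) -` lev k a \<subseteq> (\<Union>s\<in>?B. lev (Suc k) (s + a))"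
  proof
    fix x assume x: "x \<in> lev k a - (T ^^ m) -` lev k a"
    then obtain s where s: "s \<in> P k" "x \<in> lev (Suc k) (s + a)" using lev_step assms by blast
    have "s + m \<notin> P k"
    proof
      assume sm: "s + m \<in> P k"
      then have "(T ^^ m) x \<in> lev (Suc k) (s + a + m)"
        using top[OF sm] s(2) by (intro T_funpow_lev) (auto simp: add_ac)
      then have "(T ^^ m) x \<in> lev (Suc k) (s + m + a)" by (simp only: add_ac)
      then show False using lev_Suc_subset[OF sm assms] x by blast
    qed
    then show "x \<in> (\<Union>s\<in>?B. lev (Suc k) (s + a))" using s by blast
  qed
  then have "measure M (lev k a - (T ^^ m) -` lev k a) \<le> measure M (\<Union>s\<in>?B. lev (Suc k) (s + a))"
    using top P_fin lev_sets by (intro finite_measure_mono sets.finite_UN) auto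
  also have "\<dots> \<le> (\<Sum>s\<in>?B. measure M (lev (Suc k) (s + a)))"
    using top P_fin lev_sets by (intro finite_measure_subadditive_finite) auto
  also have "\<dots> = (\<Sum>s\<in>?B. w (Suc k))"
    using top measure_lev by (intro sum.cong) auto
  finally show ?thesis by simp
qed

text \<open>A point that leaves \<open>lev j a\<close> also leaves the smaller level of tower
  \<open>k\<close> containing it. The losses of all \<open>h k\<close> levels add up to at most
  \<open>e\<close> times the total length, which is at most 1.\<close>

lemma measure_lev_no_return_le_ratio:
  assumes "a < h j" "j < k" and bad: "real (card {s \<in> P k. s + m \<notin> P k}) \<le> e * real (card (P k))" "0 \<le> e"
  shows "measure M (lev j a - (T ^^ m) -` lev j a) \<le> e"
proof -
  interpret prob_space M by (rule prob_space_unit_interval_measure)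
  have T: "T \<in> measurable M M" "T ^^ m \<in> measurable M M"
    using T_measurable funpow_measure_preserving[OF T_measurable distr_T] by auto
  have diff: "lev k b - (T ^^ m) -` lev k b \<in> sets M" if "b < h k" for b
  proof -
    have "lev k b - (T ^^ m) -` lev k b = lev k b - ((T ^^ m) -` lev k b \<inter> space M)"
      using lev_subset[OF that] by auto
    then show ?thesis using measurable_sets[OF T(2) lev_sets[OF that]] lev_sets[OF that] by simp
  qed
  have "lev j a - (T ^^ m) -` lev j a \<subseteq> (\<Union>b<h k. lev k b - (T ^^ m) -` lev k b)"
  proof
    fix x assume x: "x \<in> lev j a - (T ^^ m) -` lev j a"
    then obtain b where "b + 1 < h k" "x \<in> lev k b" "lev k b \<subseteq> lev j a"
      using lev_later[of x j a k] assms by blast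
    moreover from this have "b < h k" by simp
    ultimately show "x \<in> (\<Union>b<h k. lev k b - (T ^^ m) -` lev k b)" using x by blast
  qed
  then have "measure M (lev j a - (T ^^ m) -` lev j a) \<le> measure M (\<Union>b<h k. lev k b - (T ^^ m) -` lev k b)"
    using diff by (intro finite_measure_mono sets.finite_UN) auto
  also have "\<dots> \<le> (\<Sum>b<h k. measure M (lev k b - (T ^^ m) -` lev k b))"
    using diff by (intro finite_measure_subadditive_finite) auto
  also have "\<dots> \<le> (\<Sum>b<h k. e * w k)"
  proof (rule sum_mono)
    fix b assume "b \<in> {..<h k}"
    then have "measure M (lev k b - (T ^^ m) -` lev k b) \<le> real (card {s \<in> P k. s + m \<notin> P k}) * w (Suc k)"
      using measure_lev_no_return_le by simp
    also have "\<dots> \<le> e * real (card (P k)) * w (Suc k)"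
      using bad w_pos[of "Suc k"] by (intro mult_right_mono) auto
    finally show "measure M (lev k b - (T ^^ m) -` lev k b) \<le> e * w k"
      by (simp add: w_Suc[of k] mult.assoc)
  qed
  also have "\<dots> = e * (real (h k) * w k)" by simp
  also have "\<dots> \<le> e * 1" using total_le_one[of k] bad(2) by (rule mult_left_mono)
  finally show ?thesis by simp
qed

text \<open>A time from \<open>F k\<close> loses at most the proportion \<open>2 / (k + 2)\<close>
  of the copies, and times far out in \<open>m\<close> come from large \<open>k\<close>.\<close>

lemma rigidity_sequence_T:
  assumes F: "\<And>k x. x \<in> F k \<Longrightarrow> (k + 2) * card {s \<in> P k. s + x \<notin> P k} \<le> 2 * card (P k)"
    and m: "\<And>K. eventually (\<lambda>n. \<exists>k\<ge>K. m n \<in> F k) sequentially"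
  shows "rigidity_sequence M T m"
proof (rule rigidity_sequenceI_generator[OF invertible_pmp_system_T])
  show "sets M = sigma_sets (space M) (insert {} gen)" using sets_M by simp
  fix A assume "A \<in> insert {} gen"
  then consider "A = {}" | j a where "A = lev j a" "a < h j" by (auto simp: gen_def)
  then show "(\<lambda>n. measure M (A - (T ^^ m n) -` A)) \<longlonglongrightarrow> 0"
  proof cases
    case 2
    show ?thesis
    proof (rule LIMSEQ_I)
      fix e :: real assume e: "0 < e"
      obtain K where K: "2 / e < real K" using reals_Archimedean2 by blast
      obtain n0 where n0: "\<And>n. n0 \<le> n \<Longrightarrow> \<exists>k\<ge>max K (Suc j). m n \<in> F k"
        using m[of "max K (Suc j)"] by (auto simp: eventually_sequentially)
      have "measure M (A - (T ^^ m n) -` A) < e" if n: "n0 \<le> n" for n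
      proof -
        obtain k where k: "K \<le> k" "j < k" "m n \<in> F k" using n0[OF n] by auto
        have "real (k + 2) * real (card {s \<in> P k. s + m n \<notin> P k}) \<le> 2 * real (card (P k))"
          using F[OF k(3)] by (metis of_nat_le_iff of_nat_mult of_nat_numeral)
        then have "real (card {s \<in> P k. s + m n \<notin> P k}) \<le> 2 / real (k + 2) * real (card (P k))"
          by (simp add: field_simps)
        then have "measure M (A - (T ^^ m n) -` A) \<le> 2 / real (k + 2)"
          unfolding 2(1) by (intro measure_lev_no_return_le_ratio[OF 2(2) k(2)]) auto
        also have "\<dots> < e"
        proof -
          have "2 / e < real (k + 2)" using K k(1) by simp
          then show ?thesis using e by (simp add: field_simps)
        qed
        finally show ?thesis .
      qed
      then show "\<exists>n0. \<forall>n\<ge>n0. norm (measure M (A - (T ^^ m n) -` A) - 0) < e" by auto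
    qed
  qed simp
qed

end

section \<open>The rigidity sequence: the increasing enumeration of all families
  \<open>F k\<close>\<close>

lemma exists_rigid_cut_stack_sequence:
  "\<exists>m :: nat \<Rightarrow> nat. strict_mono m \<and> (\<forall>n. 0 < m n) \<and>
    (\<forall>l::complex. norm l = 1 \<longrightarrow> (\<lambda>n. l ^ m n) \<longlonglongrightarrow> 1 \<longrightarrow> l = 1) \<and>
    (\<exists>T. invertible_pmp_system unit_interval_measure T \<and> rigidity_sequence unit_interval_measure T m \<and>
      non_atomic unit_interval_measure \<and>
      (\<forall>f :: real \<Rightarrow> complex. integrable unit_interval_measure f \<longrightarrow>
        (AE x in unit_interval_measure. f (T x) = f x) \<longrightarrow> (\<exists>c. AE x in unit_interval_measure. f x = c)))"
proof -
  obtain h P F where hPF: "\<And>k. k < h k"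
    "\<And>k. cutting_step (k + 2) ((1/2) ^ (k + 2)) (h k) (h (Suc k)) (P k) (F k)"
    using exists_cutting_sequence by blast
  then have F: "finite (F k)" "F k \<noteq> {}" "\<And>x. x \<in> F k \<Longrightarrow> h k \<le> x"
    "\<And>x. x \<in> F k \<Longrightarrow> (k + 2) * card {s \<in> P k. s + x \<notin> P k} \<le> 2 * card (P k)"
    "\<And>l::complex. norm l = 1 \<Longrightarrow> (\<And>x. x \<in> F k \<Longrightarrow> norm (l ^ x - 1) \<le> 1/2) \<Longrightarrow>
       norm (l - 1) \<le> real (k + 2) * (2/3) ^ (k + 2)" for k
    unfolding cutting_step_def by blast+
  obtain w pl rk where "cut_stack h P w pl rk"
    using exists_cut_stack[OF hPF(2)] hPF(1) by (metis gr_zeroI not_less_zero)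
  then interpret cut_stack h P w pl rk .
  define A where "A = (\<Union>k. F k)"
  \<comment> \<open>Every \<open>F k\<close> is nonempty and its elements are at least
    \<open>h k\<close>, which exceeds \<open>k\<close>.\<close>
  have A_inf: "infinite A"
  proof
    assume "finite A"
    then obtain b where b: "\<And>x. x \<in> A \<Longrightarrow> x \<le> b" by (meson Max_ge)
    obtain x where "x \<in> F b" using F(2) by blast
    then have "h b \<le> x" "x \<le> b" using F(3) b by (auto simp: A_def)
    then show False using hPF(1)[of b] by simp
  qed
  define m where "m = enumerate A"
  have m_mono: "strict_mono m" unfolding m_def by (rule strict_mono_enumerate[OF A_inf])
  have m_in: "m n \<in> A" for n unfolding m_def by (rule enumerate_in_set[OF A_inf])
  have m_surj: "\<exists>n. m n = x" if "x \<in> A" for x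
    unfolding m_def using enumerate_Ex[OF A_inf that] by blast
  have m_pos: "0 < m n" for n
  proof -
    obtain k where "m n \<in> F k" using m_in[of n] by (auto simp: A_def)
    then show ?thesis using F(3) hPF(1)[of k] by fastforce
  qed
  have "rigidity_sequence M T m"
  proof (rule rigidity_sequence_T[OF F(4)])
    fix K
    \<comment> \<open>Only finitely many times belong to an \<open>F k\<close> with
      \<open>k < K\<close>, and \<open>m\<close> eventually exceeds them all.\<close>
    define B where "B = (\<Union>k<K. F k)"
    have "finite B" unfolding B_def using F(1) by blast
    then obtain b where b: "\<And>x. x \<in> B \<Longrightarrow> x \<le> b" by (meson Max_ge)
    have "\<exists>k\<ge>K. m n \<in> F k" if "b < n" for n
    proof -
      have "m n \<notin> B" using b[of "m n"] strict_mono_imp_increasing[OF m_mono, of n] that by auto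
      then show ?thesis using m_in[of n] unfolding A_def B_def by (metis UN_iff lessThan_iff not_le_imp_less)
    qed
    then show "eventually (\<lambda>n. \<exists>k\<ge>K. m n \<in> F k) sequentially"
      by (intro eventually_mono[OF eventually_gt_at_top[of b]])
  qed
  moreover have "l = 1" if l: "norm l = 1" "(\<lambda>n. l ^ m n) \<longlonglongrightarrow> 1" for l :: complex
  proof -
    have "eventually (\<lambda>n. dist (l ^ m n) 1 < 1/2) sequentially"
      using l(2) by (rule tendstoD) simp
    then obtain n0 where n0: "\<And>n. n0 \<le> n \<Longrightarrow> norm (l ^ m n - 1) < 1/2"
      by (auto simp: eventually_sequentially dist_norm)
    \<comment> \<open>For \<open>k\<close> beyond \<open>m n0\<close> the whole of
      \<open>F k\<close> occurs in \<open>m\<close> at indices from \<open>n0\<close> on, so the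
      eigenvalue bound of the cutting step applies to all large \<open>k\<close>.\<close>
    have "norm (l - 1) \<le> real (k + 2) * (2/3) ^ (k + 2)" if k: "m n0 \<le> k" for k
    proof (rule F(5)[OF l(1)])
      fix x assume x: "x \<in> F k"
      then obtain n where n: "m n = x" using m_surj by (auto simp: A_def)
      have "m n0 \<le> m n" using F(3)[OF x] hPF(1)[of k] k n by linarith
      then have "n0 \<le> n" using strict_mono_less_eq[OF m_mono] by blast
      then show "norm (l ^ x - 1) \<le> 1/2" using n0[of n] n by simp
    qed
    moreover have "(\<lambda>k. real (k + 2) * (2/3) ^ (k + 2)) \<longlonglongrightarrow> 0"
    proof -
      have "(\<lambda>k. real k * (2/3) ^ k) \<longlonglongrightarrow> 0"
        by (rule powser_times_n_limit_0) simp
      then show ?thesis by (rule LIMSEQ_ignore_initial_segment)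
    qed
    ultimately have "norm (l - 1) \<le> 0"
      by (intro LIMSEQ_le_const) blast+
    then show ?thesis by simp
  qed
  ultimately show ?thesis
    using m_mono m_pos invertible_pmp_system_T non_atomic_M T_ergodic by blast
qed

theorem mainTheorem3:
  shows "(\<exists>m :: nat \<Rightarrow> nat.
            strict_mono m \<and> (\<forall>n. 0 < m n) \<and>
            (\<exists>(M :: real measure) T.
               standard_nonatomic_prob_space M \<and> invertible_pmp_system M T \<and>
               weakly_mixing M T \<and> rigidity_sequence M T m) \<and>
            never_rigid_with_eigenvalue TYPE(real) m)
       \<and> (\<forall>m :: nat \<Rightarrow> nat.
            strict_mono m \<and> never_rigid_with_eigenvalue TYPE(real) m \<longrightarrow>
            never_rigid_with_eigenvalue TYPE('a) m)"
proof
  let ?M = unit_interval_measure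
  obtain m T where m: "strict_mono m" "\<And>n. 0 < m n"
    and char: "\<And>l::complex. norm l = 1 \<Longrightarrow> (\<lambda>n. l ^ m n) \<longlonglongrightarrow> 1 \<Longrightarrow> l = 1"
    and T: "invertible_pmp_system ?M T" "rigidity_sequence ?M T m" "non_atomic ?M"
    and erg: "\<And>f :: real \<Rightarrow> complex. integrable ?M f \<Longrightarrow> AE x in ?M. f (T x) = f x \<Longrightarrow>
      \<exists>c. AE x in ?M. f x = c"
    using exists_rigid_cut_stack_sequence by blast
  have never: "\<mu> = 1" if "invertible_pmp_system N S" "koopman_eigenfunction N S \<mu> f" "rigidity_sequence N S m"
    for N :: "real measure" and S \<mu> f
    using char eigenvalue_norm[OF that(1,2)] eigenvalue_power_tendsto[OF that] by blast
  have "weakly_mixing ?M T"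
    unfolding weakly_mixing_def
  proof (intro allI impI)
    fix \<mu> f assume eig: "koopman_eigenfunction ?M T \<mu> f"
    \<comment> \<open>Rigidity along \<open>m\<close> excludes every other eigenvalue, so an
      eigenfunction is invariant and ergodicity makes it constant.\<close>
    then have "\<mu> = 1" using never T by blast
    then have "AE x in ?M. f (T x) = f x" using eigenfunction_AE[OF T(1) eig] by simp
    moreover have "integrable ?M f"
    proof -
      interpret prob_space ?M by (rule prob_space_unit_interval_measure)
      note f = eigenfunction_measurable[OF T(1) eig]
      have "integrable ?M (\<lambda>x. norm (f x))"
        by (rule square_integrable_imp_integrable[OF measurable_compose[OF f borel_measurable_norm]
              eigenfunction_integrable[OF T(1) eig]])
      then show ?thesis using integrable_norm_iff[OF f] by blast
    qed
    ultimately show "\<exists>c. AE x in ?M. f x = c" using erg by blast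
  qed
  moreover have "standard_nonatomic_prob_space ?M"
    using prob_space_unit_interval_measure standard_borel_unit_interval_measure T(3)
    by (simp add: standard_nonatomic_prob_space_def)
  moreover have "never_rigid_with_eigenvalue TYPE(real) m"
    unfolding never_rigid_with_eigenvalue_def koopman_eigenvalue_def using never by blast
  ultimately show "\<exists>m :: nat \<Rightarrow> nat.
            strict_mono m \<and> (\<forall>n. 0 < m n) \<and>
            (\<exists>(M :: real measure) T.
               standard_nonatomic_prob_space M \<and> invertible_pmp_system M T \<and>
               weakly_mixing M T \<and> rigidity_sequence M T m) \<and>
            never_rigid_with_eigenvalue TYPE(real) m"
    using m T by blast
next
  \<comment> \<open>A system on \<open>'a\<close> that is rigid along \<open>m\<close> with
    eigenvalue \<open>\<mu>\<close> would have a factor on \<open>real\<close> with the same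
    eigenvalue, rigid along the same \<open>m\<close>.\<close>
  show "\<forall>m :: nat \<Rightarrow> nat.
            strict_mono m \<and> never_rigid_with_eigenvalue TYPE(real) m \<longrightarrow>
            never_rigid_with_eigenvalue TYPE('a) m"
    unfolding never_rigid_with_eigenvalue_def using eigenvalue_factor_on_real by blast
qed

end
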